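(* There is a universal constant $C>0$ such that for every $n \ge 2$ and all $n$-dimensional (full-rank) lattices $\mathcal{L}_1,\mathcal{L}_2 \subset \mathbb{R}^n$, \[ M(\mathcal{L}_1,\mathcal{L}_2)\cdot M(\mathcal{L}_2,\mathcal{L}_1) \;\le\; \mathrm{dist}(\mathcal{L}_1,\mathcal{L}_2) \;\le\; n^{C\log n}\cdot M(\mathcal{L}_1,\mathcal{L}_2)\cdot M(\mathcal{L}_2,\mathcal{L}_1). \] (In the paper's notation, the upper bound is $n^{O(\log n)}\cdot M(\mathcal{L}_1,\mathcal{L}_2)\, M(\mathcal{L}_2,\mathcal{L}_1)$.)
   Context: A full-rank lattice $\mathcal{L}\subset\mathbb{R}^n$ is the set of all integer linear combinations of $n$ linearly independent vectors. The $i$-th successive minimum $\lambda_i(\mathcal{L})$ is the least $r>0$ such that $\mathcal{L}$ contains $i$ linearly independent vectors of Euclidean norm at most $r$. For two $n$-dimensional lattices, $M(\mathcal{L}_1,\mathcal{L}_2)=\max_{i\in[n]}\lambda_i(\mathcal{L}_2)/\lambda_i(\mathcal{L}_1)$. For an invertible linear map $T$, $\kappa(T)=\|T\|\,\|T^{-1}\|$, where $\|T\|=\sup_{\|x\|=1}\|Tx\|$ is the operator norm. The distortion is $\mathrm{dist}(\mathcal{L}_1,\mathcal{L}_2)=\min\{\kappa(T): T \text{ linear},\ T(\mathcal{L}_1)=\mathcal{L}_2\}$. *)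

theory Defs
  imports "Jordan_Normal_Form.VS_Connect"
begin

text \<open>
  The constant in the theorem is chosen before the dimension, so the dimension must be a term:
  \<open>\<real>\<close>^n is \<open>carrier_vec n\<close>, and linear maps are functions that are only relevant on \<open>carrier_vec n\<close>.
\<close>

abbreviation lin_indpt_vec :: "nat \<Rightarrow> real vec set \<Rightarrow> bool" where
  "lin_indpt_vec n S \<equiv>
    \<not> LinearCombinations.module.lin_dep (class_ring :: real ring) (module_vec TYPE(real) n) S"

abbreviation linear_map_vec :: "nat \<Rightarrow> (real vec \<Rightarrow> real vec) \<Rightarrow> bool" where
  "linear_map_vec n T \<equiv>
    linear_map (class_ring :: real ring) (module_vec TYPE(real) n) (module_vec TYPE(real) n) T"

definition eucl_norm :: "real vec \<Rightarrow> real" where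
  "eucl_norm v = sqrt (v \<bullet> v)"

definition full_rank_lattice :: "nat \<Rightarrow> real vec set \<Rightarrow> bool" where
  "full_rank_lattice n L \<longleftrightarrow>
    (\<exists>bs. length bs = n \<and> distinct bs \<and> set bs \<subseteq> carrier_vec n \<and> lin_indpt_vec n (set bs)
      \<and> L = vec_module.lattice_of n bs)"

definition succ_min :: "nat \<Rightarrow> nat \<Rightarrow> real vec set \<Rightarrow> real" where
  "succ_min n i L =
    (LEAST r. r > 0 \<and>
      (\<exists>S. S \<subseteq> L \<and> finite S \<and> card S = i \<and> lin_indpt_vec n S \<and> (\<forall>v\<in>S. eucl_norm v \<le> r)))"

definition min_ratio :: "nat \<Rightarrow> real vec set \<Rightarrow> real vec set \<Rightarrow> real" where
  "min_ratio n L1 L2 = Max ((\<lambda>i. succ_min n i L2 / succ_min n i L1) ` {1..n})"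

definition op_norm :: "nat \<Rightarrow> (real vec \<Rightarrow> real vec) \<Rightarrow> real" where
  "op_norm n T = (SUP x \<in> {x \<in> carrier_vec n. eucl_norm x = 1}. eucl_norm (T x))"

definition cond_number :: "nat \<Rightarrow> (real vec \<Rightarrow> real vec) \<Rightarrow> real" where
  "cond_number n T = op_norm n T * op_norm n (inv_into (carrier_vec n) T)"

text \<open>
  A linear map of \<open>\<real>\<close>^n that takes one full-rank lattice onto another is automatically bijective on
  \<open>carrier_vec n\<close>, so its condition number is meaningful.
\<close>

definition lattice_distortion :: "nat \<Rightarrow> real vec set \<Rightarrow> real vec set \<Rightarrow> real" where
  "lattice_distortion n L1 L2 =
    (LEAST k. \<exists>T. linear_map_vec n T \<and> T ` L1 = L2 \<and> k = cond_number n T)"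

end

theory Submission
  imports Defs "HOL-Analysis.Inner_Product" "HOL-Combinatorics.List_Permutation"
begin

text \<open>
  The lower bound holds because a linear map \<open>T\<close> with \<open>T L1 = L2\<close> carries independent short vectors of
  \<open>L1\<close> to independent vectors of \<open>L2\<close> that are longer by a factor of at most \<open>\<parallel>T\<parallel>\<close>.

  For the upper bound, Seysen's theorem provides a basis \<open>c\<close> of each lattice with dual basis \<open>d\<close> such that
  \<open>\<parallel>c i\<parallel> \<parallel>d i\<parallel> \<le> K\<close>, where \<open>K = n^O(log n)\<close>. Ordered by length, such a basis satisfies
  \<open>\<parallel>c i\<parallel> \<le> K \<lambda>(i)\<close> and \<open>\<parallel>d i\<parallel> \<le> K / \<lambda>(i)\<close>: among \<open>i\<close> independent lattice vectors one has a
  nonzero, hence at least unit, integer coordinate of index at least \<open>i\<close>. The map matching the two bases then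
  has condition number at most \<open>n^2 K^4\<close> times the product of the two ratios.

  Seysen's theorem is proved from a Korkine--Zolotarev basis. Minkowski's bound \<open>\<lambda>(1) = O(sqrt m) det^(1/m)\<close>,
  applied to all blocks of the Gram--Schmidt norms, shows that these norms drop by a factor of at most
  \<open>n^O(log n)\<close>. Now split the basis into halves, treat the first half and the projection of
  the second one recursively, and size-reduce the lifted second half against the first. The length bounds on
  the basis and on its dual grow by a factor of at most \<open>1 + n\<close> in each of the \<open>log n\<close> levels.
\<close>

section \<open>Lattices and their bases\<close>

text \<open>The obstacle is that lengths of basis vectors and of dual vectors must be controlled at
  once: the map matching two bases is a sum of rank-one maps
  \<open>x \<mapsto> inner x (d i) *\<^sub>R c' i\<close>, with \<open>d\<close> dual to a basis of
  \<open>L1\<close> and \<open>c'\<close> a basis of \<open>L2\<close>. For a size-reduced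
  Korkine--Zolotarev basis, inverting the unitriangular matrix of its coefficients bounds the dual
  vectors only exponentially in \<open>n\<close>. With halving, a dual vector is corrected once per
  level instead of once per index, so the loss is one factor for each of the \<open>log n\<close>
  levels. Another point is that the distortion and the successive minima are least elements of sets
  of reals, so they have to be attained. Both times this is a finiteness argument: a ball contains
  finitely many lattice vectors, and a linear map is determined by the images of a basis, which are
  short vectors of \<open>L2\<close> once the condition number is bounded. Linear independence of a
  list is carried along as the existence of a dual list, since this survives elementary operations
  and projections by explicit formulas.\<close>

primrec int_span :: "'a::real_vector list \<Rightarrow> 'a set" where
  "int_span [] = {0}"
| "int_span (b # bs) = {of_int k *\<^sub>R b + v |k v. v \<in> int_span bs}"

lemma int_span_Cons_I: "v \<in> int_span bs \<Longrightarrow> of_int k *\<^sub>R b + v \<in> int_span (b # bs)"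
  by auto

lemma zero_in_int_span [simp]: "0 \<in> int_span bs"
proof (induction bs)
  case (Cons b bs)
  then show ?case using int_span_Cons_I[of 0 bs 0 b] by simp
qed simp

lemma int_span_add: "u \<in> int_span bs \<Longrightarrow> v \<in> int_span bs \<Longrightarrow> u + v \<in> int_span bs"
proof (induction bs arbitrary: u v)
  case (Cons b bs)
  then obtain k l u' v' where "u = of_int k *\<^sub>R b + u'" "v = of_int l *\<^sub>R b + v'"
      "u' \<in> int_span bs" "v' \<in> int_span bs"
    by auto
  with Cons.IH have "u + v = of_int (k + l) *\<^sub>R b + (u' + v')" "u' + v' \<in> int_span bs"
    by (auto simp: algebra_simps)
  then show ?case
    by (metis int_span_Cons_I)
qed auto

lemma int_span_scale: "v \<in> int_span bs \<Longrightarrow> of_int k *\<^sub>R v \<in> int_span bs"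
proof (induction bs arbitrary: v)
  case (Cons b bs)
  then obtain l v' where "v = of_int l *\<^sub>R b + v'" "v' \<in> int_span bs"
    by auto
  with Cons.IH have "of_int k *\<^sub>R v = of_int (k * l) *\<^sub>R b + of_int k *\<^sub>R v'"
      "of_int k *\<^sub>R v' \<in> int_span bs"
    by (auto simp: algebra_simps)
  then show ?case
    by (metis int_span_Cons_I)
qed auto

lemma int_span_diff: "u \<in> int_span bs \<Longrightarrow> v \<in> int_span bs \<Longrightarrow> u - v \<in> int_span bs"
  using int_span_add[of u bs "- v"] int_span_scale[of v bs "- 1"] by auto

lemma int_span_base: "b \<in> set bs \<Longrightarrow> b \<in> int_span bs"
proof (induction bs)
  case (Cons a bs)
  show ?case
  proof (cases "b = a")
    case True
    then show ?thesis using int_span_Cons_I[of 0 bs 1 a] by simp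
  next
    case False
    then show ?thesis using Cons int_span_Cons_I[of b bs 0 a] by simp
  qed
qed auto

lemma int_span_minimal:
  assumes "set bs \<subseteq> int_span cs"
  shows "int_span bs \<subseteq> int_span cs"
  using assms
  by (induction bs) (auto intro!: int_span_add int_span_scale)

lemma int_span_mono: "set bs \<subseteq> set cs \<Longrightarrow> int_span bs \<subseteq> int_span cs"
  using int_span_base by (intro int_span_minimal) blast

lemma int_span_subset_span: "int_span bs \<subseteq> span (set bs)"
proof (induction bs)
  case (Cons b bs)
  have "span (set bs) \<subseteq> span (set (b # bs))"
    by (intro span_mono) auto
  with Cons show ?case
    by (auto intro!: span_add span_scale intro: span_base)
qed auto

lemma int_span_map:
  assumes "linear f"
  shows "int_span (map f bs) = f ` int_span bs"
proof (induction bs)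
  case Nil
  then show ?case using linear_0[OF assms] by simp
next
  case (Cons b bs)
  then show ?case
    by (force simp: linear_add[OF assms] linear_scale[OF assms] image_iff)
qed

text \<open>The recursive form suits induction along the list; coefficients indexed by position
  match \<open>lattice_of\<close> and pair off against a dual basis.\<close>

lemma int_span_conv_sum:
  "int_span bs = range (\<lambda>z::nat \<Rightarrow> int. \<Sum>i<length bs. of_int (z i) *\<^sub>R bs ! i)"
proof (induction bs)
  case (Cons b bs)
  have 1: "of_int k *\<^sub>R b + (\<Sum>i<length bs. of_int (z i) *\<^sub>R bs ! i)
      = (\<Sum>i<length (b # bs). of_int ((case_nat k z) i) *\<^sub>R (b # bs) ! i)" for k z
    by (simp add: sum.lessThan_Suc_shift del: sum.lessThan_Suc)
  have 2: "(\<Sum>i<length (b # bs). of_int (z i) *\<^sub>R (b # bs) ! i)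
      = of_int (z 0) *\<^sub>R b + (\<Sum>i<length bs. of_int ((z \<circ> Suc) i) *\<^sub>R bs ! i)" for z :: "nat \<Rightarrow> int"
    by (simp add: sum.lessThan_Suc_shift del: sum.lessThan_Suc)
  show ?case
  proof (intro equalityI subsetI)
    fix v assume "v \<in> int_span (b # bs)"
    then obtain k z where "v = of_int k *\<^sub>R b + (\<Sum>i<length bs. of_int (z i) *\<^sub>R bs ! i)"
      using Cons by auto
    then show "v \<in> range (\<lambda>z::nat \<Rightarrow> int. \<Sum>i<length (b # bs). of_int (z i) *\<^sub>R (b # bs) ! i)"
      unfolding 1 by blast
  next
    fix v assume "v \<in> range (\<lambda>z::nat \<Rightarrow> int. \<Sum>i<length (b # bs). of_int (z i) *\<^sub>R (b # bs) ! i)"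
    then obtain z :: "nat \<Rightarrow> int" where "v = (\<Sum>i<length (b # bs). of_int (z i) *\<^sub>R (b # bs) ! i)"
      by blast
    then show "v \<in> int_span (b # bs)"
      unfolding 2 using Cons int_span_Cons_I by blast
  qed
qed auto

text \<open>
  Equivalence by elementary operations rather than by equality of the lattices: such operations lift along
  linear maps, in particular along projections, without any independence assumption.
\<close>

inductive basis_equiv :: "'a::real_vector list \<Rightarrow> 'a list \<Rightarrow> bool" where
  same: "basis_equiv bs bs"
| step: "basis_equiv bs cs \<Longrightarrow> i < length cs \<Longrightarrow> j < length cs \<Longrightarrow> i \<noteq> j
    \<Longrightarrow> basis_equiv bs (cs[i := cs ! i + of_int z *\<^sub>R cs ! j])"

lemma basis_equiv_length: "basis_equiv bs cs \<Longrightarrow> length cs = length bs"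
  by (induction rule: basis_equiv.induct) auto

lemma basis_equiv_trans:
  assumes "basis_equiv bs cs" "basis_equiv as bs"
  shows "basis_equiv as cs"
  using assms by (induction rule: basis_equiv.induct) (auto intro: basis_equiv.step)

lemma basis_equiv_elementary:
  "i < length cs \<Longrightarrow> j < length cs \<Longrightarrow> i \<noteq> j
    \<Longrightarrow> basis_equiv cs (cs[i := cs ! i + of_int z *\<^sub>R cs ! j])"
  by (intro basis_equiv.intros)

lemma basis_equiv_append_left:
  assumes "basis_equiv bs cs"
  shows "basis_equiv (as @ bs) (as @ cs)"
  using assms
proof (induction rule: basis_equiv.induct)
  case (step bs cs i j z)
  then show ?case
    using basis_equiv.step[of "as @ bs" "as @ cs" "length as + i" "length as + j" z]
    by (simp add: list_update_append)
qed (rule basis_equiv.same)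

lemma basis_equiv_append_right:
  assumes "basis_equiv bs cs"
  shows "basis_equiv (bs @ as) (cs @ as)"
  using assms
proof (induction rule: basis_equiv.induct)
  case (step bs cs i j z)
  then show ?case
    using basis_equiv.step[of "bs @ as" "cs @ as" i j z]
    by (simp add: nth_append list_update_append)
qed (rule basis_equiv.same)

text \<open>An elementary step consists of two positions and an integer, so it can be replayed on
  preimages. Reductions found for a projected list are pulled back in this way.\<close>

lemma basis_equiv_lift:
  assumes "basis_equiv bs cs" "linear f" "bs = map f as"
  shows "\<exists>as'. basis_equiv as as' \<and> map f as' = cs"
  using assms
proof (induction rule: basis_equiv.induct)
  case (same bs)
  then show ?case by (blast intro: basis_equiv.same)
next
  case (step bs cs i j z)
  then obtain as' where as': "basis_equiv as as'" "map f as' = cs" by blast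
  have "map f (as'[i := as' ! i + of_int z *\<^sub>R as' ! j]) = cs[i := cs ! i + of_int z *\<^sub>R cs ! j]"
    using step as'
    by (auto simp: map_update linear_add linear_scale)
  moreover have "basis_equiv as (as'[i := as' ! i + of_int z *\<^sub>R as' ! j])"
    using step as' by (intro basis_equiv.step) auto
  ultimately show ?case by blast
qed

lemma basis_equiv_int_span: "basis_equiv bs cs \<Longrightarrow> int_span cs = int_span bs"
proof (induction rule: basis_equiv.induct)
  case (step bs cs i j z)
  let ?cs = "cs[i := cs ! i + of_int z *\<^sub>R cs ! j]"
  have "set ?cs \<subseteq> int_span cs"
    using step set_update_subset_insert[of cs i]
    by (auto simp: int_span_base int_span_add int_span_scale dest!: set_update_subset_insert[THEN subsetD])
  moreover have "x \<in> int_span ?cs" if "x \<in> set cs" for x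
  proof -
    obtain l where l: "l < length cs" "x = cs ! l"
      using \<open>x \<in> set cs\<close> by (auto simp: in_set_conv_nth)
    have mem: "?cs ! m \<in> int_span ?cs" if "m < length cs" for m
      using that by (intro int_span_base nth_mem) simp
    show ?thesis
    proof (cases "l = i")
      case True
      \<comment> \<open>As \<open>i \<noteq> j\<close>, entry \<open>j\<close> is unchanged, so
        subtracting the same multiple undoes the step.\<close>
      then have "x = ?cs ! i - of_int z *\<^sub>R ?cs ! j"
        using l step by simp
      then show ?thesis
        using mem step by (simp only: int_span_diff int_span_scale)
    next
      case False
      then show ?thesis using l mem[of l] by simp
    qed
  qed
  ultimately have "int_span ?cs = int_span cs"
    by (intro equalityI int_span_minimal) auto
  with step show ?case by simp
qed simp

lemma basis_equiv_span:
  assumes "basis_equiv bs cs"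
  shows "span (set cs) = span (set bs)"
proof -
  have "set cs \<subseteq> span (set bs)" "set bs \<subseteq> span (set cs)"
    using basis_equiv_int_span[OF assms] int_span_subset_span int_span_base by blast+
  then show ?thesis
    by (simp add: span_eq)
qed

text \<open>One elementary step per generator of the combination; the prefix \<open>as\<close>
  absorbs the generators already dealt with.\<close>

lemma basis_equiv_add_int_span:
  assumes "v \<in> int_span cs"
  shows "basis_equiv (as @ cs @ bs @ y # zs) (as @ cs @ bs @ (y + v) # zs)"
  using assms
proof (induction cs arbitrary: as v y)
  case Nil
  then show ?case by (simp add: basis_equiv.same)
next
  case (Cons c cs)
  then obtain k v' where v: "v = of_int k *\<^sub>R c + v'" "v' \<in> int_span cs" by auto
  let ?l = "as @ (c # cs) @ bs @ y # zs"
  let ?i = "length as + Suc (length cs) + length bs"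
  have "?l ! ?i = y" "?l ! length as = c"
    by (simp_all add: nth_append)
  moreover have "?l[?i := y'] = as @ (c # cs) @ bs @ y' # zs" for y'
    by (simp add: list_update_append)
  ultimately have "basis_equiv ?l (as @ (c # cs) @ bs @ (y + of_int k *\<^sub>R c) # zs)"
    using basis_equiv_elementary[of ?i ?l "length as" k] by simp
  moreover have "basis_equiv ((as @ [c]) @ cs @ bs @ (y + of_int k *\<^sub>R c) # zs)
      ((as @ [c]) @ cs @ bs @ (y + of_int k *\<^sub>R c + v') # zs)"
    using v by (intro Cons.IH)
  ultimately show ?case
    using basis_equiv_trans by (simp add: v add.assoc) blast
qed

lemma basis_equiv_map_add:
  assumes "\<And>y. y \<in> set ys \<Longrightarrow> g y \<in> int_span cs"
  shows "basis_equiv (cs @ bs @ ys) (cs @ bs @ map (\<lambda>y. y + g y) ys)"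
  using assms
proof (induction ys arbitrary: bs)
  case Nil
  then show ?case by (simp add: basis_equiv.same)
next
  case (Cons y ys)
  have "basis_equiv (cs @ bs @ y # ys) (cs @ bs @ (y + g y) # ys)"
    using basis_equiv_add_int_span[of "g y" cs "[]"] Cons.prems by simp
  moreover have "basis_equiv (cs @ bs @ (y + g y) # ys)
      (cs @ bs @ (y + g y) # map (\<lambda>y. y + g y) ys)"
    using Cons.IH[of "bs @ [y + g y]"] Cons.prems by simp
  ultimately show ?case
    using basis_equiv_trans by auto
qed

text \<open>The subtractive Euclidean algorithm on the pair of coefficients. Replacing
  \<open>c\<close> by \<open>c + s b\<close> keeps the combined vector if \<open>k\<close> becomes
  \<open>k - s l\<close>; the sign \<open>s\<close> is chosen so that the larger coefficient
  shrinks. The \<open>g\<close> reached at the end is the gcd up to sign.\<close>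

lemma basis_equiv_euclid:
  "\<exists>b' c' g. basis_equiv (b # c # cs) (b' # c' # cs) \<and> of_int k *\<^sub>R b + of_int l *\<^sub>R c = of_int g *\<^sub>R b'"
proof (induction "nat \<bar>k\<bar> + nat \<bar>l\<bar>" arbitrary: k l b c rule: less_induct)
  case less
  have first: "basis_equiv (b # c # cs) ((b + of_int z *\<^sub>R c) # c # cs)" for z b c
    using basis_equiv_elementary[of 0 "b # c # cs" 1 z] by simp
  have second: "basis_equiv (b # c # cs) (b # (c + of_int z *\<^sub>R b) # cs)" for z b c
    using basis_equiv_elementary[of 1 "b # c # cs" 0 z] by simp
  consider "l = 0" | "k = 0" | "k \<noteq> 0" "l \<noteq> 0" "\<bar>l\<bar> \<le> \<bar>k\<bar>" | "k \<noteq> 0" "l \<noteq> 0" "\<bar>k\<bar> < \<bar>l\<bar>"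
    by linarith
  then show ?case
  proof cases
    case 1
    then show ?thesis
      by (intro exI[of _ b] exI[of _ c] exI[of _ k]) (simp add: basis_equiv.same)
  next
    case 2
    \<comment> \<open>The pairs are \<open>(b, c)\<close>, \<open>(b + c, c)\<close>,
      \<open>(b + c, - b)\<close>, \<open>(c, - b)\<close>. Elementary steps have determinant 1,
      hence the sign in the exchange.\<close>
    have "basis_equiv (b # c # cs) (c # - b # cs)"
      using basis_equiv_trans[OF basis_equiv_trans[OF first[of "b + c" "- b" 1]]]
        second[of "b + c" c "- 1"] first[of b c 1] by simp
    with 2 show ?thesis
      by (intro exI[of _ c] exI[of _ "- b"] exI[of _ l]) simp
  next
    case 3
    define s where "s = sgn k * sgn l"
    have "\<bar>k - s * l\<bar> = \<bar>k\<bar> - \<bar>l\<bar>"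
      using 3 by (auto simp: s_def sgn_if)
    then have "nat \<bar>k - s * l\<bar> + nat \<bar>l\<bar> < nat \<bar>k\<bar> + nat \<bar>l\<bar>"
      using 3 by (simp add: zless_nat_conj)
    from less[OF this, of b "c + of_int s *\<^sub>R b"] obtain b' c' g
      where "basis_equiv (b # (c + of_int s *\<^sub>R b) # cs) (b' # c' # cs)"
        "of_int (k - s * l) *\<^sub>R b + of_int l *\<^sub>R (c + of_int s *\<^sub>R b) = of_int g *\<^sub>R b'"
      by blast
    moreover have "of_int (k - s * l) *\<^sub>R b + of_int l *\<^sub>R (c + of_int s *\<^sub>R b)
        = of_int k *\<^sub>R b + of_int l *\<^sub>R c"
      by (simp add: algebra_simps)
    ultimately show ?thesis
      using basis_equiv_trans[OF _ second[of b c s]]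
      by (intro exI[of _ b'] exI[of _ c'] exI[of _ g]) auto
  next
    case 4
    define s where "s = sgn k * sgn l"
    have "\<bar>l - s * k\<bar> = \<bar>l\<bar> - \<bar>k\<bar>"
      using 4 by (auto simp: s_def sgn_if)
    then have "nat \<bar>k\<bar> + nat \<bar>l - s * k\<bar> < nat \<bar>k\<bar> + nat \<bar>l\<bar>"
      using 4 by (simp add: zless_nat_conj)
    from less[OF this, of "b + of_int s *\<^sub>R c" c] obtain b' c' g
      where "basis_equiv ((b + of_int s *\<^sub>R c) # c # cs) (b' # c' # cs)"
        "of_int k *\<^sub>R (b + of_int s *\<^sub>R c) + of_int (l - s * k) *\<^sub>R c = of_int g *\<^sub>R b'"
      by blast
    moreover have "of_int k *\<^sub>R (b + of_int s *\<^sub>R c) + of_int (l - s * k) *\<^sub>R c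
        = of_int k *\<^sub>R b + of_int l *\<^sub>R c"
      by (simp add: algebra_simps)
    ultimately show ?thesis
      using basis_equiv_trans[OF _ first[of b c s]]
      by (intro exI[of _ b'] exI[of _ c'] exI[of _ g]) auto
  qed
qed

text \<open>Euclid's algorithm, run from the end of the list to its head, gathers all coefficients
  of \<open>v\<close> in one basis vector. If \<open>v\<close> is a shortest vector, then so is
  \<open>c\<close>, since a nonzero integer factor cannot make it longer than
  \<open>v\<close>.\<close>

lemma basis_equiv_primitive_head:
  assumes "v \<in> int_span bs" "v \<noteq> 0"
  shows "\<exists>c cs k. basis_equiv bs (c # cs) \<and> v = of_int k *\<^sub>R c"
  using assms
proof (induction bs arbitrary: v)
  case (Cons b bs)
  then obtain k v' where v: "v = of_int k *\<^sub>R b + v'" "v' \<in> int_span bs" by auto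
  show ?case
  proof (cases "v' = 0")
    case True
    with v show ?thesis
      by (intro exI[of _ b] exI[of _ bs] exI[of _ k]) (simp add: basis_equiv.same)
  next
    case False
    with Cons.IH v obtain c cs l where c: "basis_equiv bs (c # cs)" "v' = of_int l *\<^sub>R c"
      by blast
    have "basis_equiv (b # bs) (b # c # cs)"
      using basis_equiv_append_left[OF c(1), of "[b]"] by simp
    moreover obtain b' c' g where "basis_equiv (b # c # cs) (b' # c' # cs)"
        "of_int k *\<^sub>R b + of_int l *\<^sub>R c = of_int g *\<^sub>R b'"
      using basis_equiv_euclid by blast
    ultimately show ?thesis
      using v c basis_equiv_trans by metis
  qed
qed auto

text \<open>Biorthogonality only. That \<open>ds\<close> lies in the span of \<open>bs\<close> is
  demanded separately, where the orthogonality of two parts depends on it.\<close>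

definition dual_basis :: "'a::real_inner list \<Rightarrow> 'a list \<Rightarrow> bool" where
  "dual_basis bs ds \<longleftrightarrow> length ds = length bs \<and>
    (\<forall>i<length bs. \<forall>j<length bs. inner (bs ! i) (ds ! j) = (if i = j then 1 else 0))"

definition has_dual :: "'a::real_inner list \<Rightarrow> bool" where
  "has_dual bs \<longleftrightarrow> (\<exists>ds. dual_basis bs ds)"

lemma basis_equiv_has_dual:
  assumes "basis_equiv bs cs" "has_dual bs"
  shows "has_dual cs"
  using assms
proof (induction rule: basis_equiv.induct)
  case (step bs cs i j z)
  then obtain ds where "dual_basis cs ds" by (auto simp: has_dual_def)
  \<comment> \<open>The dual list transforms by the inverse transpose: the indices trade places and
    the sign changes.\<close>
  then have "dual_basis (cs[i := cs ! i + of_int z *\<^sub>R cs ! j]) (ds[j := ds ! j - of_int z *\<^sub>R ds ! i])"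
    using step by (auto simp: dual_basis_def nth_list_update inner_simps)
  then show ?case by (auto simp: has_dual_def)
qed

lemma has_dual_ConsE:
  assumes "has_dual (b # bs)"
  obtains d ds where "inner b d = 1" "\<And>x. x \<in> set bs \<Longrightarrow> inner x d = 0"
    "\<And>x. x \<in> set ds \<Longrightarrow> inner b x = 0" "dual_basis bs ds"
proof -
  obtain ds' where d': "dual_basis (b # bs) ds'"
    using assms by (auto simp: has_dual_def)
  then obtain d ds where [simp]: "ds' = d # ds"
    by (cases ds') (auto simp: dual_basis_def)
  have *: "inner ((b # bs) ! i) ((d # ds) ! j) = (if i = j then 1 else 0)"
    if "i < Suc (length bs)" "j < Suc (length bs)" for i j
    using d' that by (auto simp: dual_basis_def)
  have len: "length ds = length bs"
    using d' by (auto simp: dual_basis_def)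
  show thesis
  proof
    show "inner b d = 1" using *[of 0 0] by simp
    show "inner x d = 0" if "x \<in> set bs" for x
      using that *[of "Suc _" 0] by (auto simp: in_set_conv_nth)
    show "inner b x = 0" if "x \<in> set ds" for x
      using that *[of 0 "Suc _"] by (auto simp: in_set_conv_nth len)
    show "dual_basis bs ds"
      using *[of "Suc _" "Suc _"] by (simp add: dual_basis_def len)
  qed
qed

lemma has_dual_tl: "has_dual (b # bs) \<Longrightarrow> has_dual bs"
  by (erule has_dual_ConsE) (auto simp: has_dual_def)

lemma has_dual_append:
  assumes "has_dual (bs @ cs)"
  shows "has_dual bs"
proof -
  obtain ds where ds: "dual_basis (bs @ cs) ds"
    using assms by (auto simp: has_dual_def)
  have "inner (bs ! i) (ds ! j) = (if i = j then 1 else 0)" if "i < length bs" "j < length bs" for i j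
  proof -
    have "inner ((bs @ cs) ! i) (ds ! j) = (if i = j then 1 else 0)"
      using ds that by (simp add: dual_basis_def)
    then show ?thesis using that by (simp add: nth_append)
  qed
  with ds have "dual_basis bs (take (length bs) ds)"
    by (simp add: dual_basis_def)
  then show ?thesis by (auto simp: has_dual_def)
qed

lemma inner_int_span_eq_0:
  assumes "v \<in> int_span bs" "\<And>x. x \<in> set bs \<Longrightarrow> inner x d = 0"
  shows "inner v d = 0"
  using assms by (induction bs arbitrary: v) (auto simp: inner_simps)

text \<open>Pairing with the first dual vector gives the first coefficient, which Cauchy--Schwarz
  bounds by \<open>R * norm d\<close>. What remains lies in a ball of larger radius, so the
  induction needs all radii.\<close>

lemma finite_int_span_ball:
  assumes "has_dual bs"
  shows "finite {v \<in> int_span bs. norm v \<le> R}"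
  using assms
proof (induction bs arbitrary: R)
  case (Cons b bs)
  from Cons.prems obtain d ds where d: "inner b d = 1" "\<And>x. x \<in> set bs \<Longrightarrow> inner x d = 0"
    by (metis has_dual_ConsE)
  let ?K = "\<lceil>R * norm d\<rceil>" and ?S = "{v \<in> int_span bs. norm v \<le> R + R * norm d * norm b}"
  have "{v \<in> int_span (b # bs). norm v \<le> R} \<subseteq> (\<lambda>(k, v). of_int k *\<^sub>R b + v) ` ({-?K..?K} \<times> ?S)"
  proof safe
    fix v assume v: "v \<in> int_span (b # bs)" "norm v \<le> R"
    then obtain k v' where kv: "v = of_int k *\<^sub>R b + v'" "v' \<in> int_span bs" by auto
    have "inner v d = of_int k"
      using d kv inner_int_span_eq_0[OF kv(2), of d] by (simp add: inner_simps)
    then have k: "\<bar>real_of_int k\<bar> \<le> R * norm d"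
      using Cauchy_Schwarz_ineq2[of v d] mult_right_mono[OF v(2), of "norm d"] by simp
    have "norm v' \<le> norm v + norm (of_int k *\<^sub>R b)"
      unfolding kv(1) by (metis add_diff_cancel_left' norm_triangle_ineq4 add.commute)
    also have "\<dots> \<le> R + R * norm d * norm b"
      using v(2) mult_right_mono[OF k, of "norm b"] by simp
    finally show "v \<in> (\<lambda>(k, v). of_int k *\<^sub>R b + v) ` ({-?K..?K} \<times> ?S)"
      using kv k by (intro image_eqI[of _ _ "(k, v')"]) (simp_all, linarith)
  qed
  moreover have "finite ?S"
    using Cons has_dual_tl by blast
  ultimately show ?case
    by (meson finite_SigmaI finite_atLeastAtMost_int finite_imageI finite_subset)
qed (simp add: finite_subset[of _ "{0}"])

lemma ex_shortest_vector:
  assumes "has_dual bs" "bs \<noteq> []"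
  shows "\<exists>v \<in> int_span bs. v \<noteq> 0 \<and> (\<forall>w \<in> int_span bs. w \<noteq> 0 \<longrightarrow> norm v \<le> norm w)"
proof -
  obtain b cs where bs: "bs = b # cs" using assms(2) by (cases bs) auto
  have "b \<noteq> 0" using assms(1) unfolding bs by (metis has_dual_ConsE inner_zero_left zero_neq_one)
  have "b \<in> int_span bs" by (rule int_span_base) (simp add: bs)
  let ?S = "{v \<in> int_span bs. norm v \<le> norm b} - {0}"
  have "finite ?S" "?S \<noteq> {}"
    using finite_int_span_ball[OF assms(1)] \<open>b \<in> int_span bs\<close> \<open>b \<noteq> 0\<close> by auto
  then obtain v where v: "v \<in> ?S" "\<And>w. w \<in> ?S \<Longrightarrow> norm v \<le> norm w"
    using arg_min_if_finite(1)[of ?S norm] arg_min_least[of ?S _ norm] by blast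
  have "norm v \<le> norm w" if "w \<in> int_span bs" "w \<noteq> 0" for w
    using v(1) v(2)[of w] that by (cases "norm w \<le> norm b") auto
  with v(1) show ?thesis by blast
qed

text \<open>Division by zero makes this the identity for \<open>b = 0\<close>, so linearity and
  Pythagoras hold for every \<open>b\<close>.\<close>

definition perp :: "'a::real_inner \<Rightarrow> 'a \<Rightarrow> 'a" where
  "perp b x = x - (inner x b / inner b b) *\<^sub>R b"

lemma linear_perp: "linear (perp b)"
  by (rule linearI)
    (simp_all add: perp_def inner_add_left add_divide_distrib scaleR_add_left scaleR_diff_right)

lemma inner_perp_left [simp]: "inner (perp b x) b = 0"
  by (simp add: perp_def inner_simps)

lemma perp_same [simp]: "perp b b = 0"
  by (simp add: perp_def)

lemma norm_perp: "(norm x)\<^sup>2 = (inner x b / norm b)\<^sup>2 + (norm (perp b x))\<^sup>2"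
proof (cases "b = 0")
  case False
  let ?c = "inner x b / inner b b"
  have "(norm x)\<^sup>2 = (norm (perp b x + ?c *\<^sub>R b))\<^sup>2"
    by (simp add: perp_def)
  also have "\<dots> = (norm (perp b x))\<^sup>2 + ?c\<^sup>2 * (norm b)\<^sup>2"
    by (simp only: power2_norm_eq_inner inner_add_left inner_add_right inner_scaleR_left
        inner_scaleR_right inner_perp_left inner_commute[of b "perp b x"])
       (simp add: power2_eq_square)
  also have "?c\<^sup>2 * (norm b)\<^sup>2 = (inner x b / norm b)\<^sup>2"
    using False by (simp add: power_divide dot_square_norm power2_eq_square)
  finally show ?thesis by simp
qed (simp add: perp_def)

lemma has_dual_map_perp:
  assumes "has_dual (b # bs)"
  shows "has_dual (map (perp b) bs)"
proof -
  obtain d ds where d: "\<And>x. x \<in> set ds \<Longrightarrow> inner b x = 0" "dual_basis bs ds"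
    using assms by (metis has_dual_ConsE)
  then have "dual_basis (map (perp b) bs) ds"
    by (simp add: dual_basis_def perp_def inner_simps)
  then show ?thesis by (auto simp: has_dual_def)
qed

text \<open>The part of Korkine--Zolotarev reduction that concerns the Gram--Schmidt norms; size
  reduction takes place later, between the two halves of a basis.\<close>

fun kz_reduced :: "'a::real_inner list \<Rightarrow> bool" where
  "kz_reduced [] \<longleftrightarrow> True"
| "kz_reduced (b # bs) \<longleftrightarrow>
    (\<forall>v \<in> int_span (b # bs). v \<noteq> 0 \<longrightarrow> norm b \<le> norm v) \<and> kz_reduced (map (perp b) bs)"

text \<open>A shortest vector is moved to the head, the projected tail is reduced by induction, and
  the operations used there are replayed on the tail itself. They do not touch the head and preserve
  the lattice, so the head stays shortest.\<close>

lemma ex_kz_reduced: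
  assumes "has_dual bs"
  shows "\<exists>cs. basis_equiv bs cs \<and> kz_reduced cs"
  using assms
proof (induction "length bs" arbitrary: bs)
  case 0
  then show ?case by (intro exI[of _ "[]"]) (simp add: basis_equiv.same)
next
  case (Suc m)
  then have "bs \<noteq> []" by auto
  then obtain v where v: "v \<in> int_span bs" "v \<noteq> 0"
      "\<And>w. w \<in> int_span bs \<Longrightarrow> w \<noteq> 0 \<Longrightarrow> norm v \<le> norm w"
    using ex_shortest_vector Suc.prems by metis
  then obtain c cs k where c: "basis_equiv bs (c # cs)" "v = of_int k *\<^sub>R c"
    using basis_equiv_primitive_head by metis
  have len: "length cs = m"
    using basis_equiv_length[OF c(1)] Suc.hyps by simp
  have "k \<noteq> 0" using c v by auto
  then have "1 \<le> \<bar>real_of_int k\<bar>" by linarith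
  then have "norm c \<le> norm v"
    using mult_right_mono[of 1 "\<bar>real_of_int k\<bar>" "norm c"] by (simp add: c)
  have dual: "has_dual (c # cs)"
    using basis_equiv_has_dual[OF c(1) Suc.prems] .
  then obtain es where es: "basis_equiv (map (perp c) cs) es" "kz_reduced es"
    using Suc.hyps(1)[of "map (perp c) cs"] len has_dual_map_perp by auto
  then obtain fs where fs: "basis_equiv cs fs" "map (perp c) fs = es"
    using basis_equiv_lift[OF es(1) linear_perp] by blast
  have eq: "basis_equiv bs (c # fs)"
    using basis_equiv_trans[OF basis_equiv_append_left[OF fs(1), of "[c]"]] c(1) by simp
  have "kz_reduced (c # fs)"
    using fs es v(3) \<open>norm c \<le> norm v\<close> order_trans
    unfolding kz_reduced.simps basis_equiv_int_span[OF eq] by blast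
  with eq show ?case by blast
qed

section \<open>Gram--Schmidt norms of Korkine--Zolotarev bases\<close>

text \<open>Projecting the tail, instead of orthogonalising the list, makes this unfold in step with
  \<open>kz_reduced\<close>. For independent \<open>bs\<close> the product of the entries is the
  determinant of the lattice.\<close>

fun gs_norms :: "'a::real_inner list \<Rightarrow> real list" where
  "gs_norms [] = []"
| "gs_norms (b # bs) = norm b # gs_norms (map (perp b) bs)"

lemma length_gs_norms [simp]: "length (gs_norms bs) = length bs"
  by (induction bs rule: gs_norms.induct) auto

lemma gs_norms_pos:
  assumes "has_dual bs" "a \<in> set (gs_norms bs)"
  shows "0 < a"
  using assms
proof (induction bs rule: gs_norms.induct)
  case (2 b bs)
  have "b \<noteq> 0" using "2.prems"(1) by (auto elim: has_dual_ConsE)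
  then show ?case using 2 has_dual_map_perp by auto
qed auto

text \<open>Coordinates in the normalised Gram--Schmidt frame of \<open>bs\<close>. A component of
  \<open>v\<close> orthogonal to \<open>bs\<close> leaves no trace, so they determine the norm only
  for \<open>v\<close> in the span.\<close>

fun gs_coords :: "'a::real_inner list \<Rightarrow> 'a \<Rightarrow> real list" where
  "gs_coords [] v = []"
| "gs_coords (b # bs) v = (inner v b / norm b) # gs_coords (map (perp b) bs) (perp b v)"

lemma length_gs_coords [simp]: "length (gs_coords bs v) = length bs"
  by (induction bs v rule: gs_coords.induct) auto

lemma gs_coords_diff:
  "i < length bs \<Longrightarrow> gs_coords bs (v - w) ! i = gs_coords bs v ! i - gs_coords bs w ! i"
proof (induction bs v arbitrary: w i rule: gs_coords.induct)
  case (2 b bs v)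
  then show ?case
    by (cases i) (simp_all add: inner_diff_left diff_divide_distrib linear_diff[OF linear_perp])
qed auto

lemma norm_le_gs_coords:
  assumes "v \<in> int_span bs" "\<And>c. c \<in> set (gs_coords bs v) \<Longrightarrow> \<bar>c\<bar> \<le> s"
  shows "(norm v)\<^sup>2 \<le> real (length bs) * s\<^sup>2"
  using assms
proof (induction bs v rule: gs_coords.induct)
  case (2 b bs v)
  from "2.prems"(1) obtain k v' where v: "v = of_int k *\<^sub>R b + v'" "v' \<in> int_span bs" by auto
  have "perp b v = perp b v'"
    by (simp add: v linear_add[OF linear_perp] linear_scale[OF linear_perp])
  then have "perp b v \<in> int_span (map (perp b) bs)"
    using v by (simp add: int_span_map[OF linear_perp])
  then have "(norm (perp b v))\<^sup>2 \<le> real (length bs) * s\<^sup>2"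
    using 2 by auto
  moreover have "(inner v b / norm b)\<^sup>2 \<le> s\<^sup>2"
    using power_mono[of "\<bar>inner v b / norm b\<bar>" s 2] "2.prems"(2)[of "inner v b / norm b"]
    by (simp del: abs_divide)
  ultimately show ?case
    by (simp add: norm_perp[of v b] algebra_simps)
qed auto

text \<open>The ceiling picks the first point of the progression \<open>t + \<int> a\<close> in
  \<open>[0, a)\<close>; the points following it, one for each \<open>j\<close>, still fit below
  \<open>R\<close>.\<close>

lemma int_shift_in_interval:
  fixes a t R :: real
  assumes "0 < a" "j < nat \<lfloor>R / a\<rfloor>"
  shows "0 \<le> of_int (\<lceil>- t / a\<rceil> + int j) * a + t" "of_int (\<lceil>- t / a\<rceil> + int j) * a + t < R"
proof -
  have "- t = (- t / a) * a" using assms(1) by simp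
  moreover have "(- t / a) * a \<le> of_int \<lceil>- t / a\<rceil> * a"
    using assms(1) by (intro mult_right_mono) auto
  moreover have "of_int \<lceil>- t / a\<rceil> * a < (- t / a + 1) * a"
    using assms(1) of_int_ceiling_le_add_one ceiling_correct[of "- t / a"]
    by (intro mult_strict_right_mono) linarith+
  ultimately have 1: "- t \<le> of_int \<lceil>- t / a\<rceil> * a" "of_int \<lceil>- t / a\<rceil> * a < - t + a"
    by (simp_all only: distrib_right mult_1)
  have "real j + 1 \<le> R / a"
    using assms(2) by linarith
  then have 2: "real j * a + a \<le> R" "0 \<le> real j * a"
    using assms(1) by (simp_all add: field_simps)
  show "0 \<le> of_int (\<lceil>- t / a\<rceil> + int j) * a + t" "of_int (\<lceil>- t / a\<rceil> + int j) * a + t < R"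
    using 1 2 unfolding of_int_add of_int_of_nat_eq distrib_right by linarith+
qed

text \<open>Each point found for the projected list is lifted, and the lift is translated by
  multiples of \<open>b\<close>. A translation changes the first coordinate alone, so the number of
  admissible translations is the same floor for every lift and the counts multiply.\<close>

lemma ex_many_points_in_cube:
  assumes "has_dual bs"
  shows "\<exists>P. P \<subseteq> int_span bs \<and> finite P \<and>
    card P = prod_list (map (\<lambda>a. nat \<lfloor>R / a\<rfloor>) (gs_norms bs)) \<and>
    (\<forall>p\<in>P. \<forall>c\<in>set (gs_coords bs p). 0 \<le> c \<and> c < R)"
  using assms
proof (induction bs rule: gs_norms.induct)
  case 1
  then show ?case by (intro exI[of _ "{0}"]) simp
next
  case (2 b bs)
  let ?m = "prod_list (map (\<lambda>a. nat \<lfloor>R / a\<rfloor>) (gs_norms (map (perp b) bs)))"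
  obtain P where P: "P \<subseteq> int_span (map (perp b) bs)" "finite P" "card P = ?m"
      "\<And>p c. p \<in> P \<Longrightarrow> c \<in> set (gs_coords (map (perp b) bs) p) \<Longrightarrow> 0 \<le> c \<and> c < R"
    using "2.IH"[OF has_dual_map_perp[OF "2.prems"]] by blast
  have "b \<noteq> 0" using "2.prems" by (auto elim: has_dual_ConsE)
  then have pos: "0 < norm b" by simp
  have "\<forall>p\<in>P. \<exists>w. w \<in> int_span bs \<and> perp b w = p"
    using P(1) by (auto simp: int_span_map[OF linear_perp])
  then obtain lft where lft: "\<And>p. p \<in> P \<Longrightarrow> lft p \<in> int_span bs" "\<And>p. p \<in> P \<Longrightarrow> perp b (lft p) = p"
    by metis
  define k where "k p j = \<lceil>- (inner (lft p) b / norm b) / norm b\<rceil> + int j" for p j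
  define f where "f = (\<lambda>(p, j). of_int (k p j) *\<^sub>R b + lft p)"
  have perp_f: "perp b (f (p, j)) = p" if "p \<in> P" for p j
    using that lft by (simp add: f_def linear_add[OF linear_perp] linear_scale[OF linear_perp])
  let ?J = "{..<nat \<lfloor>R / norm b\<rfloor>}"
  have inj: "inj_on f (P \<times> ?J)"
  proof (rule inj_onI, clarify)
    fix p j p' j' assume *: "p \<in> P" "p' \<in> P" "f (p, j) = f (p', j')"
    then have "p = p'" using perp_f by metis
    with * have "of_int (k p j) *\<^sub>R b = of_int (k p j') *\<^sub>R b" by (simp add: f_def)
    with \<open>b \<noteq> 0\<close> show "p = p' \<and> j = j'" using \<open>p = p'\<close> by (simp add: k_def)
  qed
  have coords: "0 \<le> c \<and> c < R" if c: "c \<in> set (gs_coords (b # bs) (f (p, j)))" and pj: "p \<in> P" "j \<in> ?J" for c p j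
  proof -
    have "inner (f (p, j)) b / norm b = of_int (k p j) * norm b + inner (lft p) b / norm b"
      using pos by (simp add: f_def inner_add_left dot_square_norm power2_eq_square field_simps)
    then have "0 \<le> inner (f (p, j)) b / norm b \<and> inner (f (p, j)) b / norm b < R"
      using int_shift_in_interval[OF pos, of j R "inner (lft p) b / norm b"] pj unfolding k_def by simp
    with c P(4)[OF pj(1)] perp_f[OF pj(1)] show ?thesis by auto
  qed
  show ?case
  proof (intro exI[of _ "f ` (P \<times> ?J)"] conjI ballI)
    show "f ` (P \<times> ?J) \<subseteq> int_span (b # bs)"
      using lft by (auto simp: f_def)
    show "finite (f ` (P \<times> ?J))"
      using P by simp
    show "card (f ` (P \<times> ?J)) = prod_list (map (\<lambda>a. nat \<lfloor>R / a\<rfloor>) (gs_norms (b # bs)))"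
      using P by (simp add: card_image[OF inj] card_cartesian_product)
  qed (use coords in auto)
qed

text \<open>For \<open>x \<ge> 1\<close> the floor loses at most a factor 2; this is the origin of
  the power of 2 in Minkowski's bound below.\<close>

lemma prod_list_floor_ge:
  assumes "\<And>a. a \<in> set as \<Longrightarrow> 0 < a \<and> a \<le> R"
  shows "R ^ length as \<le> 2 ^ length as * prod_list as * real (prod_list (map (\<lambda>a. nat \<lfloor>R / a\<rfloor>) as))"
  using assms
proof (induction as)
  case (Cons a as)
  have "1 \<le> R / a" using Cons.prems[of a] by simp
  then have "1 \<le> \<lfloor>R / a\<rfloor>" by simp
  then have "real (nat \<lfloor>R / a\<rfloor>) = of_int \<lfloor>R / a\<rfloor>" "(1::real) \<le> of_int \<lfloor>R / a\<rfloor>" by simp_all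
  then have "R / a \<le> 2 * real (nat \<lfloor>R / a\<rfloor>)"
    using real_of_int_floor_add_one_gt[of "R / a"] by linarith
  then have "R \<le> 2 * a * real (nat \<lfloor>R / a\<rfloor>)"
    using Cons.prems[of a] by (simp add: field_simps)
  moreover have "R ^ length as \<le> 2 ^ length as * prod_list as * real (prod_list (map (\<lambda>a. nat \<lfloor>R / a\<rfloor>) as))"
    using Cons by simp
  moreover have "0 \<le> R" using Cons.prems[of a] by simp
  ultimately have "R * R ^ length as \<le> (2 * a * real (nat \<lfloor>R / a\<rfloor>)) *
      (2 ^ length as * prod_list as * real (prod_list (map (\<lambda>a. nat \<lfloor>R / a\<rfloor>) as)))"
    by (intro mult_mono) auto
  then show ?case by (simp add: algebra_simps)
qed simp

text \<open>
  Minkowski's bound by pigeonhole: a large cube of side \<open>K * s\<close> in Gram--Schmidt coordinates contains more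
  lattice points than it has cells of side \<open>s\<close>.
\<close>

lemma ex_short_vector:
  assumes dual: "has_dual bs" and s: "0 < s" "2 ^ length bs * prod_list (gs_norms bs) < s ^ length bs"
  shows "\<exists>v \<in> int_span bs. v \<noteq> 0 \<and> norm v \<le> sqrt (real (length bs)) * s"
proof -
  let ?m = "length bs"
  \<comment> \<open>An integer \<open>K\<close> cuts the cube into exactly \<open>K ^ m\<close>
    cells, and a large one makes its side at least every Gram--Schmidt norm, as the count of lattice
    points requires.\<close>
  obtain K :: nat where K: "sum_list (gs_norms bs) / s + 1 \<le> real K"
    using real_arch_simple by blast
  have pos: "\<And>a. a \<in> set (gs_norms bs) \<Longrightarrow> 0 < a"
    using gs_norms_pos[OF dual] .
  have "0 \<le> sum_list (gs_norms bs)"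
    using pos by (intro sum_list_nonneg) force
  with s have "0 \<le> sum_list (gs_norms bs) / s" by simp
  with K have "0 < K" by linarith
  define R where "R = real K * s"
  have "sum_list (gs_norms bs) \<le> (real K - 1) * s"
    using K s by (simp add: field_simps)
  then have "sum_list (gs_norms bs) \<le> R" using s by (simp add: R_def algebra_simps)
  moreover have "a \<le> sum_list (gs_norms bs)" if "a \<in> set (gs_norms bs)" for a
    using that pos by (intro member_le_sum_list) (auto simp: less_imp_le)
  ultimately have le: "\<And>a. a \<in> set (gs_norms bs) \<Longrightarrow> a \<le> R" by force
  obtain P where P: "P \<subseteq> int_span bs" "finite P"
      "card P = prod_list (map (\<lambda>a. nat \<lfloor>R / a\<rfloor>) (gs_norms bs))"
      "\<And>p c. p \<in> P \<Longrightarrow> c \<in> set (gs_coords bs p) \<Longrightarrow> 0 \<le> c \<and> c < R"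
    using ex_many_points_in_cube[OF dual, of R] by blast
  have "R ^ ?m \<le> 2 ^ ?m * prod_list (gs_norms bs) * real (card P)"
    using prod_list_floor_ge[of "gs_norms bs" R] pos le by (simp add: P(3))
  moreover have "0 < R" using s \<open>0 < K\<close> by (simp add: R_def)
  ultimately have "0 < card P"
    by (metis mult_zero_right of_nat_0 not_gr_zero zero_less_power not_le)
  then have "2 ^ ?m * prod_list (gs_norms bs) * real (card P) < s ^ ?m * real (card P)"
    using s by simp
  with \<open>R ^ ?m \<le> _\<close> have "real K ^ ?m * s ^ ?m < real (card P) * s ^ ?m"
    by (simp add: R_def power_mult_distrib mult.commute)
  then have card: "K ^ ?m < card P"
    using s by (simp flip: of_nat_power)
  define cell where "cell p = map (\<lambda>c. nat \<lfloor>c / s\<rfloor>) (gs_coords bs p)" for p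
  let ?C = "{xs. set xs \<subseteq> {..<K} \<and> length xs = ?m}"
  have "cell p \<in> ?C" if "p \<in> P" for p
  proof -
    have "nat \<lfloor>c / s\<rfloor> < K" if "c \<in> set (gs_coords bs p)" for c
    proof -
      have "c < real K * s" "0 \<le> c" using P(4)[OF \<open>p \<in> P\<close> that] by (auto simp: R_def)
      then have "c / s < real K" "0 \<le> c / s" using s by (simp_all add: field_simps)
      then show ?thesis by linarith
    qed
    then show ?thesis by (auto simp: cell_def)
  qed
  then have "card (cell ` P) \<le> card ?C"
    by (intro card_mono finite_lists_length_eq) auto
  also have "\<dots> = K ^ ?m" by (simp add: card_lists_length_eq)
  finally have "\<not> inj_on cell P"
    using card card_image[of cell P] by linarith
  then obtain p q where pq: "p \<in> P" "q \<in> P" "p \<noteq> q" "cell p = cell q"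
    by (auto simp: inj_on_def)
  have mem: "p - q \<in> int_span bs" using pq P(1) int_span_diff by blast
  have "\<bar>c\<bar> \<le> s" if "c \<in> set (gs_coords bs (p - q))" for c
  proof -
    obtain i where i: "i < ?m" "c = gs_coords bs p ! i - gs_coords bs q ! i"
      using \<open>c \<in> _\<close> by (auto simp: in_set_conv_nth gs_coords_diff)
    have nonneg: "0 \<le> gs_coords bs p ! i / s" "0 \<le> gs_coords bs q ! i / s"
      using P(4) pq i s by simp_all
    have "cell p ! i = cell q ! i" using pq by simp
    then have "nat \<lfloor>gs_coords bs p ! i / s\<rfloor> = nat \<lfloor>gs_coords bs q ! i / s\<rfloor>"
      using i by (simp add: cell_def)
    \<comment> \<open>Both quotients are nonnegative, so \<open>nat\<close> truncates nothing and
      the floors agree.\<close>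
    then have "\<bar>gs_coords bs p ! i / s - gs_coords bs q ! i / s\<bar> \<le> 1"
      using nonneg by linarith
    then show ?thesis
      using s by (simp add: i flip: diff_divide_distrib)
  qed
  from norm_le_gs_coords[OF mem this] have "norm (p - q) \<le> sqrt (real ?m * s\<^sup>2)"
    by (intro real_le_rsqrt) auto
  also have "\<dots> = sqrt (real ?m) * s" using s by (simp add: real_sqrt_mult)
  finally show ?thesis using mem pq by (intro bexI[of _ "p - q"]) auto
qed

section \<open>Decay of the Gram--Schmidt norms\<close>

lemma gs_norms_take: "gs_norms (take m bs) = take m (gs_norms bs)"
proof (induction bs arbitrary: m rule: gs_norms.induct)
  case (2 b bs)
  then show ?case by (cases m) (simp_all flip: take_map)
qed simp

lemma prod_list_pos: "(\<And>a. a \<in> set as \<Longrightarrow> 0 < (a::real)) \<Longrightarrow> 0 < prod_list as"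
  by (induction as) auto

lemma ln_prod_list: "(\<And>a. a \<in> set as \<Longrightarrow> 0 < a) \<Longrightarrow> ln (prod_list as) = (\<Sum>a\<leftarrow>as. ln (a::real))"
proof (induction as)
  case (Cons a as)
  have "0 < prod_list as" using Cons.prems by (intro prod_list_pos) auto
  moreover have "0 < a" using Cons.prems by simp
  ultimately show ?case using Cons by (simp add: ln_mult_pos)
qed simp

text \<open>The head is shortest in the whole lattice, so Minkowski's bound for the sublattice of
  the first \<open>m\<close> vectors applies to it. In logarithms the root of the determinant
  becomes an average.\<close>

lemma kz_reduced_hd_le:
  assumes "kz_reduced bs" "has_dual bs" "0 < m" "m \<le> length bs"
  shows "ln (gs_norms bs ! 0) \<le> ln (3 * sqrt m) + (\<Sum>i<m. ln (gs_norms bs ! i)) / m"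
proof -
  obtain b bs' where bs: "bs = b # bs'" using assms by (cases bs) auto
  let ?t = "take m bs" let ?a = "gs_norms bs"
  \<comment> \<open>Three times the geometric mean of the norms; the pigeonhole argument asks for
    strictly more than twice.\<close>
  define s where "s = exp (ln 3 + (\<Sum>i<m. ln (?a ! i)) / m)"
  have dual: "has_dual ?t"
    by (rule has_dual_append[of ?t "drop m bs"]) (simp add: assms)
  have len: "length ?t = m" using assms by simp
  have pos: "\<And>a. a \<in> set (gs_norms ?t) \<Longrightarrow> 0 < a" using gs_norms_pos[OF dual] .
  have "ln (prod_list (gs_norms ?t)) = (\<Sum>i<m. ln (?a ! i))"
    using assms by (simp add: ln_prod_list[OF pos] sum_list_sum_nth gs_norms_take atLeast0LessThan)
  then have prod: "prod_list (gs_norms ?t) = exp (\<Sum>i<m. ln (?a ! i))"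
    using prod_list_pos[OF pos] by (metis exp_ln)
  have "s ^ m = exp (real m * (ln 3 + (\<Sum>i<m. ln (?a ! i)) / m))"
    by (simp add: s_def flip: exp_of_nat_mult)
  also have "\<dots> = exp (real m * ln 3) * exp (\<Sum>i<m. ln (?a ! i))"
    using assms by (simp add: distrib_left exp_add)
  also have "\<dots> = 3 ^ m * prod_list (gs_norms ?t)"
    by (simp add: exp_of_nat_mult prod)
  finally have "2 ^ length ?t * prod_list (gs_norms ?t) < s ^ length ?t"
    using assms prod_list_pos[OF pos] by (simp add: power_strict_mono)
  then obtain v where v: "v \<in> int_span ?t" "v \<noteq> 0" "norm v \<le> sqrt (real m) * s"
    using ex_short_vector[OF dual, of s] len by (auto simp: s_def)
  have "int_span ?t \<subseteq> int_span bs"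
    by (intro int_span_mono set_take_subset)
  then have "norm b \<le> norm v" using assms(1) v by (auto simp: bs simp del: int_span.simps)
  then have "norm b \<le> sqrt (real m) * s" using v by simp
  moreover have "0 < norm b"
    using gs_norms_pos[OF assms(2), of "norm b"] by (simp add: bs)
  ultimately have "ln (norm b) \<le> ln (sqrt (real m) * s)"
    using assms by (simp add: s_def)
  also have "\<dots> = ln (3 * sqrt m) + (\<Sum>i<m. ln (?a ! i)) / m"
    using assms by (simp add: ln_mult s_def)
  finally show ?thesis by (simp add: bs)
qed

text \<open>The projected tail of a reduced list is again reduced, so a block may begin at any
  index.\<close>

lemma kz_reduced_block_le:
  assumes "kz_reduced bs" "has_dual bs" "i + m \<le> length bs" "0 < m"
  shows "ln (gs_norms bs ! i) \<le> ln (3 * sqrt m) + (\<Sum>k<m. ln (gs_norms bs ! (i + k))) / m"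
  using assms
proof (induction i arbitrary: bs)
  case 0
  then show ?case using kz_reduced_hd_le[of bs m] by simp
next
  case (Suc i)
  then obtain b cs where bs: "bs = b # cs" by (cases bs) auto
  then show ?case
    using Suc.IH[of "map (perp b) cs"] Suc.prems has_dual_map_perp by auto
qed

text \<open>Makes the harmonic sum below telescope to a logarithm. The factor 2 pays for passing
  from \<open>1 / (L + 1)\<close>, which the logarithm dominates, to \<open>1 / L\<close>.\<close>

lemma harmonic_step:
  assumes "0 < L"
  shows "1 / real L \<le> 2 * (ln (real (Suc L)) - ln (real L))"
proof -
  have "ln (real L / real (Suc L)) \<le> real L / real (Suc L) - 1"
    using assms by (intro ln_le_minus_one) simp
  also have "\<dots> = - (1 / real (Suc L))"
    by (simp add: field_simps)
  finally have *: "1 / real (Suc L) \<le> ln (real (Suc L)) - ln (real L)"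
    using assms by (simp add: ln_div)
  have "1 / real L \<le> 2 * (1 / real (Suc L))"
    using assms by (simp add: field_simps)
  also have "\<dots> \<le> 2 * (ln (real (Suc L)) - ln (real L))"
    using * by (intro mult_left_mono) simp_all
  finally show ?thesis .
qed

text \<open>Blocks end at the fixed index \<open>j\<close> and grow to the left. If \<open>A\<close>
  is the average of a block of length \<open>L + 2\<close> and \<open>B\<close> that of the block
  without its first entry, then \<open>x i \<le> G + A\<close> gives
  \<open>A \<le> B + G / (L + 1)\<close>, and these increments form a harmonic sum.\<close>

lemma average_bound:
  fixes x :: "nat \<Rightarrow> real"
  assumes G: "0 \<le> G"
    and avg: "\<And>m i. 0 < m \<Longrightarrow> i + m \<le> Suc j \<Longrightarrow> x i \<le> G + (\<Sum>k<m. x (i + k)) / m"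
    and ij: "i + L = j"
  shows "(\<Sum>k<Suc L. x (i + k)) / Suc L \<le> x j + 2 * G * ln (Suc L)"
  using ij
proof (induction L arbitrary: i)
  case (Suc L)
  define A where "A = (\<Sum>k<Suc (Suc L). x (i + k)) / Suc (Suc L)"
  define B where "B = (\<Sum>k<Suc L. x (Suc i + k)) / Suc L"
  have "(\<Sum>k<Suc (Suc L). x (i + k)) = x i + (\<Sum>k<Suc L. x (Suc i + k))"
    by (subst sum.lessThan_Suc_shift) simp
  then have "(real L + 2) * A = x i + (real L + 1) * B"
    by (simp add: A_def B_def add.commute del: sum.lessThan_Suc)
  moreover have "x i \<le> G + A"
    using avg[of "Suc (Suc L)" i] Suc.prems unfolding A_def by simp
  ultimately have "(real L + 1) * A \<le> G + (real L + 1) * B"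
    by (simp add: algebra_simps)
  then have "A \<le> B + G * (1 / real (Suc L))"
    by (simp add: field_simps)
  also have "\<dots> \<le> (x j + 2 * G * ln (Suc L)) + G * (2 * (ln (real (Suc (Suc L))) - ln (real (Suc L))))"
    using Suc.IH[of "Suc i"] Suc.prems harmonic_step[of "Suc L"] G
    unfolding B_def by (intro add_mono mult_left_mono) auto
  finally show ?case unfolding A_def by (simp add: algebra_simps del: sum.lessThan_Suc)
qed simp

lemma kz_reduced_gs_norms_le:
  assumes kz: "kz_reduced bs" "has_dual bs" and len: "length bs \<le> n" and ij: "i \<le> j" "j < length bs"
  shows "gs_norms bs ! i \<le> exp (ln (3 * sqrt n) * (1 + 2 * ln n)) * gs_norms bs ! j"
proof -
  let ?G = "ln (3 * sqrt n)" let ?x = "\<lambda>i. ln (gs_norms bs ! i)"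
  have n: "1 \<le> n" using len ij by linarith
  then have "1 \<le> sqrt n" by simp
  then have G: "0 \<le> ?G" by (intro ln_ge_zero) linarith
  have avg: "?x i \<le> ?G + (\<Sum>k<m. ?x (i + k)) / m" if "0 < m" "i + m \<le> Suc j" for m i
  proof -
    have "ln (3 * sqrt m) \<le> ?G"
      using that ij len by simp
    with kz_reduced_block_le[OF kz, of i m] that ij show ?thesis by linarith
  qed
  define L where "L = j - i"
  have L: "i + L = j" "Suc L \<le> n" using ij len by (auto simp: L_def)
  \<comment> \<open>In the factor \<open>1 + 2 * ln n\<close>, the 1 comes from this single use of
    the block inequality and the logarithm from the bound on the average.\<close>
  have "?x i \<le> ?G + (\<Sum>k<Suc L. ?x (i + k)) / Suc L"
    using L by (intro avg) auto
  also have "(\<Sum>k<Suc L. ?x (i + k)) / Suc L \<le> ?x j + 2 * ?G * ln (Suc L)"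
    by (rule average_bound[OF G avg L(1)])
  also have "2 * ?G * ln (Suc L) \<le> 2 * ?G * ln n"
    using L n G by (intro mult_left_mono) auto
  finally have le: "?x i \<le> ?x j + ?G * (1 + 2 * ln n)"
    by (simp add: algebra_simps)
  have pos: "0 < gs_norms bs ! i" "0 < gs_norms bs ! j"
    using gs_norms_pos[OF kz(2)] ij by auto
  have "gs_norms bs ! i = exp (?x i)" using pos by simp
  also have "\<dots> \<le> exp (?x j + ?G * (1 + 2 * ln n))" using le by simp
  also have "\<dots> = exp (?G * (1 + 2 * ln n)) * gs_norms bs ! j"
    using pos by (simp add: exp_add)
  finally show ?thesis .
qed

section \<open>Seysen reduction\<close>

text \<open>The remaining vectors are projected along with \<open>y\<close>, so that later
  projections keep the orthogonality already gained.\<close>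

fun perps :: "'a::real_inner list \<Rightarrow> 'a \<Rightarrow> 'a" where
  "perps [] y = y"
| "perps (x # xs) y = perps (map (perp x) xs) (perp x y)"

lemma perps_Cons: "perps (x # xs) = perps (map (perp x) xs) \<circ> perp x"
  by auto

lemma linear_perps: "linear (perps xs)"
proof (induction "length xs" arbitrary: xs)
  case 0
  then show ?case by (auto intro!: linearI)
next
  case (Suc m)
  then obtain x xs' where xs: "xs = x # xs'" "length xs' = m" by (cases xs) auto
  then show ?case
    using Suc.hyps(1)[of "map (perp x) xs'"] by (simp add: perps_Cons linear_compose linear_perp)
qed

lemma diff_perps_in_span: "y - perps xs y \<in> span (set xs)"
proof (induction xs y rule: perps.induct)
  case (2 x xs y)
  have sub: "span (perp x ` set xs) \<subseteq> span (set (x # xs))"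
    by (intro span_minimal) (auto simp: perp_def intro!: span_diff span_scale intro: span_base)
  have "y - perp x y \<in> span (set (x # xs))"
    by (auto simp: perp_def intro!: span_scale intro: span_base)
  moreover have "perp x y - perps (x # xs) y \<in> span (set (x # xs))"
    using 2 sub by auto
  ultimately show ?case
    using span_add by fastforce
qed (simp add: span_zero)

lemma inner_span_eq_0:
  assumes "v \<in> span S" "\<And>x. x \<in> S \<Longrightarrow> inner x d = 0"
  shows "inner v d = 0"
  using assms(1)
  by (induction rule: span_induct_alt) (auto simp: assms inner_add_left)

text \<open>Together with \<open>diff_perps_in_span\<close> this identifies \<open>perps xs\<close>
  as the orthogonal projection along the span of \<open>xs\<close>, whatever the order of the
  list.\<close>

lemma inner_perps_eq_0:
  assumes "x \<in> set xs"
  shows "inner (perps xs y) x = 0"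
  using assms
proof (induction xs y arbitrary: x rule: perps.induct)
  case (2 x0 xs y)
  let ?z = "perps (map (perp x0) xs) (perp x0 y)"
  \<comment> \<open>The later projections subtract only vectors that are orthogonal to
    \<open>x0\<close>.\<close>
  have "inner (perp x0 y - ?z) x0 = 0"
    by (rule inner_span_eq_0[OF diff_perps_in_span]) auto
  then have x0: "inner ?z x0 = 0" by (simp add: inner_diff_left)
  show ?case
  proof (cases "x = x0")
    case False
    then have "inner ?z (perp x0 x) = 0" using 2 by simp
    with x0 show ?thesis by (simp add: perp_def[of x0 x] inner_diff_right)
  qed (use x0 in simp)
qed simp

lemma inner_perps_span_eq_0:
  assumes "x \<in> span (set xs)"
  shows "inner x (perps xs y) = 0"
  using inner_span_eq_0[OF assms] inner_perps_eq_0 by (metis inner_commute)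

text \<open>Lets the recursion by halves work with one sequence of numbers: the projected second
  half has the norms which the whole list has in these positions.\<close>

lemma gs_norms_append: "gs_norms (xs @ ys) = gs_norms xs @ gs_norms (map (perps xs) ys)"
proof (induction "length xs" arbitrary: xs ys)
  case (Suc m)
  then obtain x xs' where xs: "xs = x # xs'" "length xs' = m" by (cases xs) auto
  have "gs_norms (map (perp x) xs' @ map (perp x) ys) =
      gs_norms (map (perp x) xs') @ gs_norms (map (perps (map (perp x) xs')) (map (perp x) ys))"
    by (intro Suc.hyps(1)) (simp add: xs)
  then show ?case by (simp add: xs perps_Cons)
qed (simp add: map_idI)

lemma has_dual_map_perps:
  assumes "has_dual (xs @ ys)"
  shows "has_dual (map (perps xs) ys)"
  using assms
proof (induction "length xs" arbitrary: xs ys)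
  case (Suc m)
  then obtain x xs' where xs: "xs = x # xs'" "length xs' = m" by (cases xs) auto
  have "has_dual (map (perp x) xs' @ map (perp x) ys)"
    using has_dual_map_perp[of x "xs' @ ys"] Suc.prems xs by simp
  then have "has_dual (map (perps (map (perp x) xs')) (map (perp x) ys))"
    using xs by (intro Suc.hyps(1)) simp_all
  then show ?case by (simp add: xs perps_Cons)
qed (simp add: map_idI)

lemma span_eq_sum_dual:
  assumes "dual_basis cs ds" "v \<in> span (set cs)"
  shows "v = (\<Sum>i<length cs. inner v (ds ! i) *\<^sub>R cs ! i)"
  using assms(2)
proof (induction rule: span_induct_alt)
  case base
  then show ?case by simp
next
  case (step c x y)
  from \<open>x \<in> set cs\<close> obtain l where l: "l < length cs" "x = cs ! l"
    by (auto simp: in_set_conv_nth)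
  have "(\<Sum>i<length cs. inner x (ds ! i) *\<^sub>R cs ! i) = (\<Sum>i<length cs. if i = l then x else 0)"
    using assms(1) l by (intro sum.cong) (auto simp: dual_basis_def)
  also have "\<dots> = x" using l by simp
  finally show ?case
    using step.IH
    by (simp add: inner_add_left scaleR_add_left sum.distrib flip: scaleR_scaleR scaleR_sum_right)
qed

section \<open>Gluing two halves, and the recursion\<close>

lemma norm_sum_scaleR_le:
  fixes v :: "nat \<Rightarrow> 'a::real_normed_vector"
  assumes "\<And>i. i < m \<Longrightarrow> \<bar>r i\<bar> \<le> 1" "\<And>i. i < m \<Longrightarrow> norm (v i) \<le> B"
  shows "norm (\<Sum>i<m. r i *\<^sub>R v i) \<le> real m * B"
proof -
  have "norm (\<Sum>i<m. r i *\<^sub>R v i) \<le> (\<Sum>i<m. norm (r i *\<^sub>R v i))"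
    by (rule norm_sum)
  also have "\<dots> \<le> (\<Sum>i<m. B)"
  proof (rule sum_mono)
    fix i assume "i \<in> {..<m}"
    then have "\<bar>r i\<bar> * norm (v i) \<le> 1 * B"
      using assms by (intro mult_mono) auto
    then show "norm (r i *\<^sub>R v i) \<le> B" by simp
  qed
  finally show ?thesis by simp
qed

text \<open>
  The numbers \<open>r i j\<close> are the rounding errors that remain after size reduction of the lifted second half.
\<close>

lemma glue_bases:
  assumes xs: "basis_equiv xs cs" "dual_basis cs ds" "set ds \<subseteq> span (set xs)"
    and ys: "basis_equiv (map (perps xs) ys) es" "dual_basis es gs"
      "set gs \<subseteq> span (perps xs ` set ys)"
  defines "k \<equiv> length xs" and "l \<equiv> length ys"
  shows "\<exists>r cs' ds'. basis_equiv (xs @ ys) cs' \<and> dual_basis cs' ds' \<and> set ds' \<subseteq> span (set (xs @ ys)) \<and>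
    (\<forall>i j. \<bar>r i j\<bar> \<le> (1::real)) \<and>
    (\<forall>i<k. cs' ! i = cs ! i \<and> ds' ! i = ds ! i - (\<Sum>j<l. r i j *\<^sub>R gs ! j)) \<and>
    (\<forall>j<l. cs' ! (k + j) = es ! j + (\<Sum>i<k. r i j *\<^sub>R cs ! i) \<and> ds' ! (k + j) = gs ! j)"
proof -
  have len: "length cs = k" "length ds = k" "length es = l" "length gs = l"
    using basis_equiv_length[OF xs(1)] basis_equiv_length[OF ys(1)] xs(2) ys(2)
    by (auto simp: dual_basis_def k_def l_def)
  obtain fs where fs: "basis_equiv ys fs" "map (perps xs) fs = es"
    using basis_equiv_lift[OF ys(1) linear_perps] by blast
  have lenf: "length fs = l" using len fs by auto
  define g where "g y = - (\<Sum>i<k. of_int (round (inner y (ds ! i))) *\<^sub>R cs ! i)" for y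
  \<comment> \<open>Rounding leaves at most 1/2. The default 0 outside the index range makes the
    bound by 1 valid for all \<open>i\<close> and \<open>j\<close>.\<close>
  define r where "r i j = (if i < k \<and> j < l then
    inner (fs ! j) (ds ! i) - of_int (round (inner (fs ! j) (ds ! i))) else 0)" for i j
  define hs where "hs = map (\<lambda>y. y + g y) fs"
  \<comment> \<open>The second half acquires \<open>r i j\<close> times \<open>cs ! i\<close>, so
    biorthogonality forces the same multiple of \<open>gs ! j\<close> out of \<open>ds ! i\<close>.
    The dual vectors of the second half stay as they are.\<close>
  define ds' where "ds' = map (\<lambda>i. ds ! i - (\<Sum>j<l. r i j *\<^sub>R gs ! j)) [0..<k]"
  have lens: "length hs = l" "length ds' = k" by (simp_all add: hs_def ds'_def lenf)
  have r: "\<bar>r i j\<bar> \<le> 1" for i j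
    using of_int_round_abs_le[of "inner (fs ! j) (ds ! i)"] by (auto simp: r_def abs_minus_commute)
  have span_cs: "span (set cs) = span (set xs)"
    using basis_equiv_span[OF xs(1)] .
  have "g y \<in> int_span cs" for y
  proof -
    have "(\<Sum>i<k. of_int (z i) *\<^sub>R cs ! i) \<in> int_span cs" for z
      unfolding int_span_conv_sum len by (rule rangeI)
    from int_span_scale[OF this, of "- 1"] show ?thesis by (simp add: g_def)
  qed
  then have "basis_equiv (cs @ fs) (cs @ hs)"
    using basis_equiv_map_add[of fs g cs "[]"] by (simp add: hs_def)
  moreover have "basis_equiv (xs @ ys) (cs @ fs)"
    using basis_equiv_trans[OF basis_equiv_append_left[OF fs(1)] basis_equiv_append_right[OF xs(1)]] .
  ultimately have equiv: "basis_equiv (xs @ ys) (cs @ hs)"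
    using basis_equiv_trans by blast
  have perp: "inner x w = 0" if x: "x \<in> span (set xs)" and w: "w \<in> span (perps xs ` set ys)" for x w
  proof -
    have "inner w x = 0"
      using inner_perps_span_eq_0[OF x] by (intro inner_span_eq_0[OF w]) (auto simp: inner_commute)
    then show ?thesis by (simp add: inner_commute)
  qed
  have mem: "cs ! i \<in> span (set xs)" "ds ! i \<in> span (set xs)" if "i < k" for i
    using that span_base[of "cs ! i" "set cs"] xs(3) len span_cs by (auto simp: subset_iff)
  have es_mem: "es ! j \<in> span (perps xs ` set ys)" "gs ! j \<in> span (perps xs ` set ys)" if "j < l" for j
    using that span_base[of "es ! j" "set es"] ys(3) len basis_equiv_span[OF ys(1)]
    by (auto simp: subset_iff)
  have cd: "inner (cs ! i) (ds ! i') = (if i = i' then 1 else 0)" if "i < k" "i' < k" for i i'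
    using xs(2) that len by (simp add: dual_basis_def)
  have eg: "inner (es ! j) (gs ! j') = (if j = j' then 1 else 0)" if "j < l" "j' < l" for j j'
    using ys(2) that len by (simp add: dual_basis_def)
  have cg: "inner (cs ! i) (gs ! j) = 0" "inner (es ! j) (ds ! i) = 0" if "i < k" "j < l" for i j
    using perp mem[OF \<open>i < k\<close>] es_mem[OF \<open>j < l\<close>] by (auto simp: inner_commute)
  have h: "hs ! j = es ! j + (\<Sum>i<k. r i j *\<^sub>R cs ! i)" if j: "j < l" for j
  proof -
    let ?y = "fs ! j"
    have e: "es ! j = perps xs ?y" using fs j lenf by auto
    have "?y - es ! j = (\<Sum>i<k. inner (?y - es ! j) (ds ! i) *\<^sub>R cs ! i)"
      using span_eq_sum_dual[OF xs(2), of "?y - es ! j"] diff_perps_in_span[of ?y xs] e span_cs len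
      by simp
    \<comment> \<open>\<open>es ! j\<close> is orthogonal to the first half, so these are the
      coefficients that \<open>g\<close> rounds.\<close>
    also have "\<dots> = (\<Sum>i<k. inner ?y (ds ! i) *\<^sub>R cs ! i)"
      using j by (intro sum.cong) (simp_all add: inner_diff_left cg)
    finally have "?y + g ?y = es ! j + (\<Sum>i<k. inner ?y (ds ! i) *\<^sub>R cs ! i) + g ?y"
      by (simp add: algebra_simps)
    also have "\<dots> = es ! j + (\<Sum>i<k. r i j *\<^sub>R cs ! i)"
      using j by (simp add: g_def r_def scaleR_diff_left sum_subtractf)
    finally show ?thesis using j lenf by (simp add: hs_def)
  qed
  have 1: "inner (cs ! i) (ds' ! i') = (if i = i' then 1 else 0)" if "i < k" "i' < k" for i i'
    using that by (simp add: ds'_def inner_diff_right inner_sum_right cd cg)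
  have 2: "inner (hs ! j) (gs ! j') = (if j = j' then 1 else 0)" if "j < l" "j' < l" for j j'
    using that by (simp add: h inner_add_left inner_sum_left eg cg)
  have 3: "inner (hs ! j) (ds' ! i) = 0" if "j < l" "i < k" for i j
  proof -
    have "inner (\<Sum>m<k. r m j *\<^sub>R cs ! m) (ds' ! i) = (\<Sum>m<k. if m = i then r i j else 0)"
      unfolding inner_sum_left using that by (intro sum.cong) (auto simp: 1)
    moreover have "inner (es ! j) (ds' ! i) = - (\<Sum>m<l. if m = j then r i j else 0)"
    proof -
      have "inner (es ! j) (\<Sum>m<l. r i m *\<^sub>R gs ! m) = (\<Sum>m<l. if m = j then r i j else 0)"
        unfolding inner_sum_right using that by (intro sum.cong) (auto simp: eg)
      then show ?thesis using that by (simp add: ds'_def inner_diff_right cg)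
    qed
    ultimately show ?thesis using that by (simp add: h inner_add_left)
  qed
  have dual: "dual_basis (cs @ hs) (ds' @ gs)"
    unfolding dual_basis_def
  proof (intro conjI allI impI)
    fix i j assume "i < length (cs @ hs)" "j < length (cs @ hs)"
    then have ij: "i < k + l" "j < k + l" by (simp_all add: len lens)
    consider "i < k" "j < k" | "i < k" "k \<le> j" | "k \<le> i" "j < k" | "k \<le> i" "k \<le> j" by linarith
    then show "inner ((cs @ hs) ! i) ((ds' @ gs) ! j) = (if i = j then 1 else 0)"
    proof cases
      case 4
      then show ?thesis using 2[of "i - k" "j - k"] ij by (auto simp: nth_append len lens)
    qed (use ij 1 3 cg in \<open>auto simp: nth_append len lens\<close>)
  qed (simp add: len lens)
  have sub: "span (set xs) \<subseteq> span (set (xs @ ys))" "span (perps xs ` set ys) \<subseteq> span (set (xs @ ys))"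
  proof -
    show 1: "span (set xs) \<subseteq> span (set (xs @ ys))" by (intro span_mono) auto
    have "perps xs y \<in> span (set (xs @ ys))" if "y \<in> set ys" for y
    proof -
      have "y \<in> span (set (xs @ ys))" using that by (intro span_base) simp
      moreover have "y - perps xs y \<in> span (set (xs @ ys))" using 1 diff_perps_in_span by blast
      ultimately have "y - (y - perps xs y) \<in> span (set (xs @ ys))" by (rule span_diff)
      then show ?thesis by simp
    qed
    then show "span (perps xs ` set ys) \<subseteq> span (set (xs @ ys))"
      by (intro span_minimal) auto
  qed
  have "ds ! i - (\<Sum>j<l. r i j *\<^sub>R gs ! j) \<in> span (set (xs @ ys))" if "i < k" for i
    using mem(2)[OF that] es_mem(2) sub by (intro span_diff span_sum span_scale) auto
  then have "set (ds' @ gs) \<subseteq> span (set (xs @ ys))"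
    using ys(3) sub by (auto simp: ds'_def)
  moreover have "(cs @ hs) ! i = cs ! i \<and> (ds' @ gs) ! i = ds ! i - (\<Sum>j<l. r i j *\<^sub>R gs ! j)" if "i < k" for i
    using that len lens by (simp add: nth_append ds'_def)
  moreover have "(cs @ hs) ! (k + j) = es ! j + (\<Sum>i<k. r i j *\<^sub>R cs ! i) \<and> (ds' @ gs) ! (k + j) = gs ! j"
    if "j < l" for j
    using that len lens h by (simp add: nth_append)
  ultimately show ?thesis
    using equiv dual r by blast
qed

text \<open>
  The monotone sequence \<open>p\<close> is what makes the recursion work: lengths in the first half are bounded by
  \<open>p\<close> at any later index, dual lengths in the second half by \<open>F / p\<close> at any earlier one.
\<close>

lemma ex_seysen_basis:
  assumes "length bs \<le> 2 ^ k" "length bs \<le> N" "has_dual bs" "mono p" "\<And>i. 0 < p i" "0 < F"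
    and "\<And>i. i < length bs \<Longrightarrow> gs_norms bs ! i \<le> p i \<and> p i \<le> F * gs_norms bs ! i"
  shows "\<exists>cs ds. basis_equiv bs cs \<and> dual_basis cs ds \<and> set ds \<subseteq> span (set bs) \<and>
    (\<forall>i<length bs. norm (cs ! i) \<le> (1 + real N) ^ k * p i \<and> norm (ds ! i) \<le> (1 + real N) ^ k * F / p i)"
  using assms
proof (induction k arbitrary: bs p)
  case 0
  show ?case
  proof (cases bs)
    case Nil
    then show ?thesis by (intro exI[of _ "[]"]) (simp add: basis_equiv.same dual_basis_def)
  next
    case (Cons b bs')
    with 0 have bs: "bs = [b]" by simp
    have "b \<noteq> 0" using 0(3) by (auto simp: bs elim: has_dual_ConsE)
    \<comment> \<open>The dual vector inside the line of \<open>b\<close>, of length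
      \<open>1 / norm b\<close>; the lower bound on \<open>gs_norms\<close> in terms of
      \<open>p\<close> is what limits it.\<close>
    let ?d = "(1 / inner b b) *\<^sub>R b"
    have "norm ?d = 1 / norm b"
      using \<open>b \<noteq> 0\<close> by (simp add: dot_square_norm power2_eq_square)
    also have "\<dots> \<le> F / p 0"
      using 0(5)[of 0] 0(7)[of 0] \<open>b \<noteq> 0\<close> by (simp add: bs field_simps)
    finally have "norm ?d \<le> F / p 0" .
    moreover have "norm b \<le> p 0" using 0(7)[of 0] by (simp add: bs)
    ultimately show ?thesis
      using \<open>b \<noteq> 0\<close> unfolding bs
      by (intro exI[of _ "[b]"] exI[of _ "[?d]"])
        (auto simp: basis_equiv.same dual_basis_def intro!: span_scale intro: span_base)
  qed
next
  case (Suc k)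
  \<comment> \<open>The first part takes all that \<open>2 ^ k\<close> allows, so the second has at
    most \<open>2 ^ k\<close> entries too; it may be empty.\<close>
  define m where "m = min (length bs) (2 ^ k)"
  define xs ys where "xs = take m bs" and "ys = drop m bs"
  have bs: "bs = xs @ ys" by (simp add: xs_def ys_def)
  have len: "length xs = m" by (simp add: xs_def m_def)
  have len_bs: "length bs = length xs + length ys" by (simp add: bs)
  have lens: "length xs \<le> 2 ^ k" "length ys \<le> 2 ^ k" "length xs \<le> N" "length ys \<le> N"
      "length xs + length ys \<le> N"
    using Suc.prems(1,2) by (auto simp: xs_def ys_def m_def)
  let ?P = "map (perps xs) ys" let ?l = "length ys"
  let ?f = "(1 + real N) ^ k"
  have gs: "gs_norms bs = gs_norms xs @ gs_norms ?P"
    unfolding bs by (rule gs_norms_append)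
  have dx: "has_dual xs" using has_dual_append Suc.prems(3) bs by metis
  have dy: "has_dual ?P" using has_dual_map_perps Suc.prems(3) bs by metis
  have "gs_norms xs ! i \<le> p i \<and> p i \<le> F * gs_norms xs ! i" if "i < length xs" for i
    using Suc.prems(7)[of i] that by (simp add: gs nth_append len_bs)
  then obtain cs ds where c: "basis_equiv xs cs" "dual_basis cs ds" "set ds \<subseteq> span (set xs)"
      "\<And>i. i < m \<Longrightarrow> norm (cs ! i) \<le> ?f * p i" "\<And>i. i < m \<Longrightarrow> norm (ds ! i) \<le> ?f * F / p i"
    using Suc.IH[OF lens(1,3) dx Suc.prems(4,5,6)] len by auto
  \<comment> \<open>The second half continues the same monotone sequence, so the bounds of the two
    halves stay comparable across the cut.\<close>
  let ?p = "\<lambda>j. p (m + j)"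
  have "gs_norms ?P ! j \<le> ?p j \<and> ?p j \<le> F * gs_norms ?P ! j" if "j < length ?P" for j
    using Suc.prems(7)[of "m + j"] that len by (simp add: gs nth_append len_bs)
  moreover have "mono ?p" using Suc.prems(4) by (auto simp: mono_def)
  ultimately obtain es gs where e: "basis_equiv ?P es" "dual_basis es gs" "set gs \<subseteq> span (perps xs ` set ys)"
      "\<And>j. j < ?l \<Longrightarrow> norm (es ! j) \<le> ?f * p (m + j)" "\<And>j. j < ?l \<Longrightarrow> norm (gs ! j) \<le> ?f * F / p (m + j)"
    using Suc.IH[of ?P ?p] lens dy Suc.prems(5,6) by auto
  obtain r cs' ds' where glue: "basis_equiv bs cs'" "dual_basis cs' ds'" "set ds' \<subseteq> span (set bs)"
      "\<forall>i j. \<bar>r i j\<bar> \<le> (1::real)"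
      "\<forall>i<m. cs' ! i = cs ! i \<and> ds' ! i = ds ! i - (\<Sum>j<?l. r i j *\<^sub>R gs ! j)"
      "\<forall>j<?l. cs' ! (m + j) = es ! j + (\<Sum>i<m. r i j *\<^sub>R cs ! i) \<and> ds' ! (m + j) = gs ! j"
    using glue_bases[OF c(1-3) e(1-3), unfolded len, folded bs] by blast
  then have new: "\<And>i j. \<bar>r i j\<bar> \<le> 1" "\<And>i. i < m \<Longrightarrow> cs' ! i = cs ! i"
      "\<And>i. i < m \<Longrightarrow> ds' ! i = ds ! i - (\<Sum>j<?l. r i j *\<^sub>R gs ! j)"
      "\<And>j. j < ?l \<Longrightarrow> cs' ! (m + j) = es ! j + (\<Sum>i<m. r i j *\<^sub>R cs ! i)"
      "\<And>j. j < ?l \<Longrightarrow> ds' ! (m + j) = gs ! j"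
    by auto
  have f: "0 < ?f" by simp
  have grow: "?f * x \<le> (1 + real N) ^ Suc k * x" if "0 \<le> x" for x
    using that by (intro mult_right_mono) auto
  \<comment> \<open>The cost of one level: the old bound, plus at most \<open>N\<close> correction
    terms of that size.\<close>
  have grow2: "?f * x + real q * (?f * x) \<le> (1 + real N) ^ Suc k * x" if "0 \<le> x" "q \<le> N" for x q
  proof -
    have "real q * (?f * x) \<le> real N * (?f * x)" using that by (intro mult_right_mono) auto
    then show ?thesis by (simp add: algebra_simps)
  qed
  have Fp: "0 \<le> F / p i" for i using Suc.prems(5)[of i] Suc.prems(6) by simp
  have p_le: "p i \<le> p j" if "i \<le> j" for i j using Suc.prems(4) that by (simp add: mono_def)
  have "norm (cs' ! i) \<le> (1 + real N) ^ Suc k * p i \<and> norm (ds' ! i) \<le> (1 + real N) ^ Suc k * F / p i"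
    if i: "i < length bs" for i
  proof (cases "i < m")
    case True
    have "norm (\<Sum>j<?l. r i j *\<^sub>R gs ! j) \<le> real ?l * (?f * (F / p i))"
    proof (rule norm_sum_scaleR_le[OF new(1)])
      fix j assume "j < ?l"
      then have "norm (gs ! j) \<le> ?f * (F / p (m + j))" using e by simp
      also have "\<dots> \<le> ?f * (F / p i)"
        using Suc.prems(5)[of i] Suc.prems(6) p_le[of i "m + j"] True
        by (intro mult_left_mono divide_left_mono) auto
      finally show "norm (gs ! j) \<le> ?f * (F / p i)" .
    qed
    then have "norm (ds' ! i) \<le> ?f * (F / p i) + real ?l * (?f * (F / p i))"
      using norm_triangle_ineq4[of "ds ! i" "\<Sum>j<?l. r i j *\<^sub>R gs ! j"] c(5)[OF True] new(3)[OF True]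
      by simp
    also have "\<dots> \<le> (1 + real N) ^ Suc k * (F / p i)"
      using grow2[OF Fp] lens by simp
    finally have "norm (ds' ! i) \<le> (1 + real N) ^ Suc k * F / p i" by simp
    moreover have "norm (cs' ! i) \<le> (1 + real N) ^ Suc k * p i"
      using order_trans[OF c(4)[OF True] grow] new(2)[OF True] Suc.prems(5)[of i] by (simp add: less_imp_le)
    ultimately show ?thesis by blast
  next
    case False
    then obtain j where j: "i = m + j" "j < ?l"
      using i len bs by (metis add_diff_inverse_nat length_append nat_add_left_cancel_less)
    have "norm (\<Sum>i'<m. r i' j *\<^sub>R cs ! i') \<le> real m * (?f * p i)"
    proof (rule norm_sum_scaleR_le[OF new(1)])
      fix i' assume "i' < m"
      then have "norm (cs ! i') \<le> ?f * p i'" using c by simp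
      also have "\<dots> \<le> ?f * p i"
        using p_le[of i' i] \<open>i' < m\<close> j by (intro mult_left_mono) auto
      finally show "norm (cs ! i') \<le> ?f * p i" .
    qed
    then have "norm (cs' ! i) \<le> ?f * p i + real m * (?f * p i)"
      using norm_triangle_ineq[of "es ! j" "\<Sum>i'<m. r i' j *\<^sub>R cs ! i'"] e(4)[OF j(2)] new(4)[OF j(2)] j
      by simp
    also have "\<dots> \<le> (1 + real N) ^ Suc k * p i"
      using grow2[of "p i" m] Suc.prems(5)[of i] lens len by (simp add: less_imp_le)
    finally have "norm (cs' ! i) \<le> (1 + real N) ^ Suc k * p i" .
    moreover have "norm (ds' ! i) \<le> (1 + real N) ^ Suc k * F / p i"
      using e(5)[OF j(2)] new(5)[OF j(2)] j grow[OF Fp[of i]] by simp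
    ultimately show ?thesis by blast
  qed
  with glue(1-3) show ?case by blast
qed

section \<open>The reduced basis, its constant, and its relation to independent lattice
  vectors\<close>

lemma dual_basisD:
  "dual_basis bs ds \<Longrightarrow> i < length bs \<Longrightarrow> j < length bs \<Longrightarrow> inner (bs ! i) (ds ! j) = (if i = j then 1 else 0)"
  by (simp add: dual_basis_def)

lemma dual_basis_permute:
  assumes "dual_basis cs ds" "f permutes {..<length cs}"
  shows "dual_basis (permute_list f cs) (permute_list f ds)"
proof -
  have "f i < length cs" if "i < length cs" for i
    using permutes_in_image[OF assms(2), of i] that by simp
  moreover have "f i = f j \<longleftrightarrow> i = j" for i j
    using permutes_inj[OF assms(2)] by (auto simp: inj_def)
  ultimately show ?thesis
    using assms by (auto simp: dual_basis_def permute_list_nth)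
qed

text \<open>Write \<open>x = ln n\<close>, so \<open>x \<ge> 1/2\<close>. From
  \<open>k \<le> 4 x\<close> and \<open>ln (1 + n) \<le> 2 x\<close> the squared power is at most
  \<open>exp (16 x^2)\<close>; from \<open>ln (3 sqrt n) \<le> 5/2 x\<close> and
  \<open>1 + 2 x \<le> 4 x\<close> the decay factor is at most \<open>exp (10 x^2)\<close>. Hence
  26.\<close>

lemma seysen_constant_le:
  assumes "2 \<le> n" "2 ^ k < 2 * n"
  shows "((1 + real n) ^ k)\<^sup>2 * exp (ln (3 * sqrt n) * (1 + 2 * ln n)) \<le> exp (26 * (ln n)\<^sup>2)"
proof -
  let ?x = "ln (real n)"
  have n: "2 \<le> real n" using assms by simp
  then have "ln 2 \<le> ?x" by simp
  have half: "1 / 2 \<le> ln (2::real)"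
    using ln_le_minus_one[of "1 / 2 :: real"] by (simp add: ln_div)
  with \<open>ln 2 \<le> ?x\<close> have x: "1 / 2 \<le> ?x" by linarith
  have "(1 + real n) \<le> real n * real n"
    using n mult_mono[OF n n] mult_right_mono[OF n, of "real n"] by linarith
  then have "ln (1 + real n) \<le> ln (real n * real n)" using n by simp
  then have l1: "ln (1 + real n) \<le> 2 * ?x" using n by (simp add: ln_mult)
  have "real k * ln 2 = ln (2 ^ k)" by (simp add: ln_realpow)
  also have "\<dots> \<le> ln (2 * real n)"
  proof -
    have "real (2 ^ k) < real (2 * n)" using assms(2) by (simp only: of_nat_less_iff)
    then have "2 ^ k \<le> 2 * real n" by simp
    then show ?thesis by (intro ln_mono) simp_all
  qed
  also have "\<dots> \<le> 2 * ?x" using n by (simp add: ln_mult)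
  finally have "real k * ln 2 \<le> 2 * ?x" .
  moreover have "real k * (1 / 2) \<le> real k * ln 2"
    using half by (intro mult_left_mono) auto
  ultimately have k: "real k \<le> 4 * ?x" by linarith
  have "(1 + real n) ^ k = exp (real k * ln (1 + real n))"
    using n by (simp add: exp_of_nat_mult)
  also have "\<dots> \<le> exp ((4 * ?x) * (2 * ?x))"
    unfolding exp_le_cancel_iff using k l1 x n by (intro mult_mono) auto
  finally have "(1 + real n) ^ k \<le> exp (8 * ?x\<^sup>2)" by (simp add: power2_eq_square)
  then have "((1 + real n) ^ k)\<^sup>2 \<le> (exp (8 * ?x\<^sup>2))\<^sup>2" by (intro power_mono) auto
  then have A: "((1 + real n) ^ k)\<^sup>2 \<le> exp (16 * ?x\<^sup>2)"
    by (simp flip: exp_of_nat_mult)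
  have "3 \<le> real n * real n" using mult_mono[OF n n] by linarith
  then have "ln 3 \<le> ln (real n * real n)" using n by simp
  then have "ln (3 * sqrt n) \<le> 5 / 2 * ?x" using n by (simp add: ln_mult ln_sqrt)
  moreover have "1 + 2 * ?x \<le> 4 * ?x" using x by linarith
  moreover have "0 \<le> ln (3 * sqrt n)" using n by (intro ln_ge_zero) (simp add: real_le_rsqrt mult_ge1_I)
  ultimately have "ln (3 * sqrt n) * (1 + 2 * ?x) \<le> (5 / 2 * ?x) * (4 * ?x)"
    using x by (intro mult_mono) auto
  then have "exp (ln (3 * sqrt n) * (1 + 2 * ?x)) \<le> exp (10 * ?x\<^sup>2)"
    by (simp add: power2_eq_square)
  with A have "((1 + real n) ^ k)\<^sup>2 * exp (ln (3 * sqrt n) * (1 + 2 * ?x)) \<le> exp (16 * ?x\<^sup>2) * exp (10 * ?x\<^sup>2)"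
    by (intro mult_mono) auto
  then show ?thesis by (simp flip: exp_add)
qed

lemma ex_power_two_between: "0 < n \<Longrightarrow> \<exists>k. n \<le> 2 ^ k \<and> 2 ^ k < 2 * (n::nat)"
proof -
  assume "0 < n"
  define k where "k = (LEAST k. n \<le> 2 ^ k)"
  have "n \<le> 2 ^ n" by (simp add: less_imp_le)
  then have "n \<le> 2 ^ k" unfolding k_def by (rule LeastI)
  moreover have "2 ^ k < 2 * n"
  proof (cases k)
    case (Suc j)
    then have "\<not> n \<le> 2 ^ j" unfolding k_def by (intro not_less_Least) simp
    then show ?thesis using Suc by simp
  qed (use \<open>0 < n\<close> in simp)
  ultimately show ?thesis by blast
qed

lemma ex_seysen_reduced_basis:
  fixes bs :: "'a::real_inner list"
  assumes dual: "has_dual bs" and n: "length bs = n" "2 \<le> n"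
  shows "\<exists>cs ds. int_span cs = int_span bs \<and> length cs = n \<and> dual_basis cs ds \<and> set ds \<subseteq> span (set bs) \<and>
    sorted (map norm cs) \<and> (\<forall>i<n. norm (cs ! i) * norm (ds ! i) \<le> exp (26 * (ln n)\<^sup>2))"
proof -
  obtain as where as: "basis_equiv bs as" "kz_reduced as"
    using ex_kz_reduced[OF dual] by blast
  have da: "has_dual as" using basis_equiv_has_dual[OF as(1) dual] .
  have la: "length as = n" using basis_equiv_length[OF as(1)] n by simp
  define F where "F = exp (ln (3 * sqrt n) * (1 + 2 * ln n))"
  have F: "0 < F" by (simp add: F_def)
  have ratio: "gs_norms as ! i \<le> F * gs_norms as ! j" if "i \<le> j" "j < n" for i j
    using kz_reduced_gs_norms_le[OF as(2) da, of n i j] that la by (simp add: F_def)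
  \<comment> \<open>The running maximum is monotone by construction, and the decay bound keeps it
    within the factor \<open>F\<close> of the current norm. It is continued constantly after index
    \<open>n - 1\<close>.\<close>
  define p where "p i = Max ((!) (gs_norms as) ` {..min i (n - 1)})" for i
  have p_ge: "gs_norms as ! j \<le> p i" if "j \<le> i" "j < n" for i j
    unfolding p_def using that by (intro Max_ge) auto
  have p_le: "p i \<le> F * gs_norms as ! i" if "i < n" for i
    unfolding p_def using that by (subst Max_le_iff) (auto intro: ratio)
  have p_pos: "0 < p i" for i
  proof -
    have "0 < gs_norms as ! 0" using n la by (intro gs_norms_pos[OF da] nth_mem) simp
    also have "\<dots> \<le> p i" using n by (intro p_ge) auto
    finally show ?thesis .
  qed
  have "mono p"
    unfolding p_def by (intro monoI Max_mono) auto
  obtain k where k: "n \<le> 2 ^ k" "2 ^ k < 2 * n"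
    using ex_power_two_between[of n] n by auto
  obtain cs ds where cs: "basis_equiv as cs" "dual_basis cs ds" "set ds \<subseteq> span (set as)"
      "\<forall>i<n. norm (cs ! i) \<le> (1 + real n) ^ k * p i \<and> norm (ds ! i) \<le> (1 + real n) ^ k * F / p i"
    using ex_seysen_basis[of as k n p F] k la da \<open>mono p\<close> p_pos F p_ge p_le by auto
  have lc: "length cs = n" using basis_equiv_length[OF cs(1)] la by simp
  have ld: "length ds = n" using cs(2) lc by (simp add: dual_basis_def)
  have prod: "norm (cs ! i) * norm (ds ! i) \<le> exp (26 * (ln n)\<^sup>2)" if "i < n" for i
  proof -
    have "norm (cs ! i) * norm (ds ! i) \<le> ((1 + real n) ^ k * p i) * ((1 + real n) ^ k * F / p i)"
      using cs(4) that p_pos[of i] by (intro mult_mono) auto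
    also have "\<dots> = ((1 + real n) ^ k)\<^sup>2 * F"
      using p_pos[of i] by (simp add: power2_eq_square)
    also have "\<dots> \<le> exp (26 * (ln n)\<^sup>2)"
      unfolding F_def using n k by (intro seysen_constant_le)
    finally show ?thesis .
  qed
  \<comment> \<open>The bound pairs \<open>cs ! i\<close> with \<open>ds ! i\<close>, so basis and
    dual may be permuted together; \<open>p\<close> cancelled from the product, and no order of
    indices has to be kept.\<close>
  have "mset (sort_key norm cs) = mset cs" by simp
  then obtain f where f: "f permutes {..<length cs}" "permute_list f cs = sort_key norm cs"
    using mset_eq_permutation by metis
  have f_less: "f i < n" if "i < n" for i
    using permutes_in_image[OF f(1), of i] that lc by simp
  have "sorted (map norm (permute_list f cs))"
    unfolding f(2) by simp
  moreover have "int_span (permute_list f cs) = int_span bs"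
    using basis_equiv_int_span[OF cs(1)] basis_equiv_int_span[OF as(1)]
      int_span_mono[of "permute_list f cs" cs] int_span_mono[of cs "permute_list f cs"] f by simp
  moreover have "set (permute_list f ds) \<subseteq> span (set bs)"
    using cs(3) basis_equiv_span[OF as(1)] f(1) lc ld by simp
  moreover have "\<forall>i<n. norm (permute_list f cs ! i) * norm (permute_list f ds ! i) \<le> exp (26 * (ln n)\<^sup>2)"
    using prod f_less f(1) lc ld by (simp add: permute_list_nth)
  ultimately show ?thesis
    using dual_basis_permute[OF cs(2) f(1)] lc by (metis length_permute_list)
qed

text \<open>Gram--Schmidt built from the end of the list: the component of \<open>b\<close>
  orthogonal to the rest, scaled, is dual to \<open>b\<close>, and subtracting multiples of it makes
  the older dual vectors vanish on \<open>b\<close>.\<close>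

lemma independent_has_dual:
  assumes "distinct bs" "independent (set bs)"
  shows "has_dual bs"
  using assms
proof (induction bs)
  case Nil
  then show ?case by (simp add: has_dual_def dual_basis_def)
next
  case (Cons b bs)
  have "independent (set bs)" using Cons.prems(2) independent_mono by (metis set_subset_Cons)
  then obtain ds where ds: "dual_basis bs ds" using Cons by (auto simp: has_dual_def)
  have "b \<notin> span (set bs)" using Cons.prems by (auto simp: dependent_def)
  define e where "e = perps bs b"
  have diff: "b - e \<in> span (set bs)" unfolding e_def by (rule diff_perps_in_span)
  with \<open>b \<notin> _\<close> have "e \<noteq> 0" by auto
  have "inner (b - e) e = 0"
    using inner_perps_span_eq_0[OF diff] by (simp add: e_def)
  define d where "d = (1 / inner e e) *\<^sub>R e"
  have bd: "inner b d = 1"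
    using \<open>inner (b - e) e = 0\<close> \<open>e \<noteq> 0\<close> by (simp add: d_def inner_diff_left)
  have xd: "inner x d = 0" if "x \<in> set bs" for x
    using inner_perps_eq_0[OF that, of b] by (simp add: d_def e_def inner_commute)
  have "dual_basis (b # bs) (d # map (\<lambda>x. x - inner b x *\<^sub>R d) ds)"
    using ds bd xd by (auto simp: dual_basis_def nth_Cons inner_diff_right split: nat.split)
  then show ?case by (auto simp: has_dual_def)
qed

lemma dual_basis_distinct: "dual_basis cs ds \<Longrightarrow> distinct cs"
  unfolding distinct_conv_nth by (metis dual_basisD zero_neq_one)

lemma dual_basis_independent:
  assumes "dual_basis cs ds"
  shows "independent (set cs)"
  unfolding dependent_def
proof clarify
  fix x assume x: "x \<in> set cs" "x \<in> span (set cs - {x})"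
  then obtain i where i: "i < length cs" "x = cs ! i" by (auto simp: in_set_conv_nth)
  have "inner x (ds ! i) = 0"
  proof (rule inner_span_eq_0[OF x(2)])
    fix y assume "y \<in> set cs - {x}"
    then obtain j where "j < length cs" "y = cs ! j" "j \<noteq> i"
      using i by (auto simp: in_set_conv_nth)
    then show "inner y (ds ! i) = 0" using dual_basisD[OF assms] i by simp
  qed
  then show False using dual_basisD[OF assms i(1) i(1)] i by simp
qed

lemma inner_int_span_dual_Ints:
  assumes "dual_basis cs ds" "v \<in> int_span cs" "j < length cs"
  shows "inner v (ds ! j) \<in> \<int>"
proof -
  obtain z :: "nat \<Rightarrow> int" where "v = (\<Sum>i<length cs. of_int (z i) *\<^sub>R cs ! i)"
    using assms(2) unfolding int_span_conv_sum by blast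
  then show ?thesis
    using dual_basisD[OF assms(1)] assms(3)
    by (auto simp: inner_sum_left intro!: Ints_sum Ints_mult)
qed

lemma independent_lattice_bound:
  assumes dual: "dual_basis cs ds" and sorted: "sorted (map norm cs)"
    and S: "\<And>i. i < length cs \<Longrightarrow> norm (cs ! i) * norm (ds ! i) \<le> K"
    and i: "i < length cs"
    and A: "A \<subseteq> int_span cs" "independent A" "card A = Suc i" "\<And>v. v \<in> A \<Longrightarrow> norm v \<le> r"
  shows "norm (cs ! i) \<le> K * r"
proof -
  have "finite A" using A(3) by (metis card.infinite nat.distinct(1))
  \<comment> \<open>Lists count from 0: the \<open>i + 1\<close> vectors of \<open>A\<close> cannot
    all lie in the span of the \<open>i\<close> entries before \<open>cs ! i\<close>.\<close>
  have "\<not> A \<subseteq> span (set (take i cs))"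
  proof
    assume "A \<subseteq> span (set (take i cs))"
    from independent_span_bound[OF _ A(2) this] have "card A \<le> card (set (take i cs))" by simp
    also have "\<dots> \<le> i" using card_length[of "take i cs"] by simp
    finally show False using A(3) by simp
  qed
  then obtain v where v: "v \<in> A" "v \<notin> span (set (take i cs))" by blast
  have vs: "v \<in> span (set cs)" using v A(1) int_span_subset_span by blast
  have "\<exists>j<length cs. i \<le> j \<and> inner v (ds ! j) \<noteq> 0"
  proof (rule ccontr)
    assume "\<not> ?thesis"
    then have *: "\<And>j. j < length cs \<Longrightarrow> i \<le> j \<Longrightarrow> inner v (ds ! j) = 0" by blast
    have "inner v (ds ! j) *\<^sub>R cs ! j \<in> span (set (take i cs))" if j: "j < length cs" for j
    proof (cases "j < i")
      case True
      then have "cs ! j \<in> set (take i cs)" using j by (metis in_set_conv_nth length_take min_less_iff_conj nth_take)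
      then show ?thesis by (intro span_scale span_base)
    next
      case False
      then show ?thesis using *[OF j] by (simp add: span_zero)
    qed
    then have "(\<Sum>j<length cs. inner v (ds ! j) *\<^sub>R cs ! j) \<in> span (set (take i cs))"
      by (intro span_sum) auto
    with span_eq_sum_dual[OF dual vs] v(2) show False by simp
  qed
  then obtain j where j: "j < length cs" "i \<le> j" "inner v (ds ! j) \<noteq> 0" by blast
  have "1 \<le> \<bar>inner v (ds ! j)\<bar>"
    using inner_int_span_dual_Ints[OF dual _ j(1)] v(1) A(1) j(3) by (intro Ints_nonzero_abs_ge1) auto
  also have "\<dots> \<le> norm v * norm (ds ! j)" by (rule Cauchy_Schwarz_ineq2)
  also have "\<dots> \<le> r * norm (ds ! j)" using A(4)[OF v(1)] by (intro mult_right_mono) auto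
  finally have "1 \<le> r * norm (ds ! j)" .
  have "0 \<le> r" using A(4)[OF v(1)] norm_ge_zero[of v] by linarith
  \<comment> \<open>The coordinate was found at some \<open>j \<ge> i\<close>; sorting carries the
    bound back from \<open>j\<close> to \<open>i\<close>.\<close>
  have "norm (cs ! i) \<le> norm (cs ! j)"
    using sorted_nth_mono[OF sorted, of i j] j by simp
  also have "\<dots> \<le> norm (cs ! j) * (r * norm (ds ! j))"
    using mult_left_mono[OF \<open>1 \<le> r * _\<close>, of "norm (cs ! j)"] by simp
  also have "\<dots> \<le> K * r"
    using mult_right_mono[OF S[OF j(1)] \<open>0 \<le> r\<close>] by (simp add: mult_ac)
  finally show ?thesis .
qed

section \<open>Transfer to coordinate vectors\<close>

text \<open>
  All the spaces \<open>carrier_vec n\<close> embed isometrically into this one inner product space, so that the results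
  above apply although the dimension is a term.
\<close>

typedef fvec = "{f :: nat \<Rightarrow> real. finite {i. f i \<noteq> 0}}"
  morphisms coord Fvec
  by (rule exI[of _ "\<lambda>_. 0"]) simp

setup_lifting type_definition_fvec

lemma finite_coord: "finite {i. coord x i \<noteq> 0}"
  using coord[of x] by simp

lemma fvec_eqI: "(\<And>i. coord x i = coord y i) \<Longrightarrow> x = y"
  by (auto simp flip: coord_inject)

lemma finite_support_combine:
  assumes "finite {i. f i \<noteq> (0::real)}" "finite {i. g i \<noteq> (0::real)}"
    and "\<And>i. f i = 0 \<Longrightarrow> g i = 0 \<Longrightarrow> h i = 0"
  shows "finite {i. h i \<noteq> (0::real)}"
  by (rule finite_subset[of _ "{i. f i \<noteq> 0} \<union> {i. g i \<noteq> 0}"]) (use assms in auto)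

instantiation fvec :: real_vector
begin

lift_definition zero_fvec :: fvec is "\<lambda>_. 0" by simp
lift_definition plus_fvec :: "fvec \<Rightarrow> fvec \<Rightarrow> fvec" is "\<lambda>f g i. f i + g i"
  by (erule (1) finite_support_combine) simp
lift_definition minus_fvec :: "fvec \<Rightarrow> fvec \<Rightarrow> fvec" is "\<lambda>f g i. f i - g i"
  by (erule (1) finite_support_combine) simp
lift_definition uminus_fvec :: "fvec \<Rightarrow> fvec" is "\<lambda>f i. - f i" by simp
lift_definition scaleR_fvec :: "real \<Rightarrow> fvec \<Rightarrow> fvec" is "\<lambda>c f i. c * f i"
  by (rule rev_finite_subset) auto

instance
  by standard (transfer; simp add: algebra_simps fun_eq_iff)+

end

lemma coord_simps [simp]:
  "coord 0 i = 0" "coord (x + y) i = coord x i + coord y i" "coord (x - y) i = coord x i - coord y i"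
  "coord (- x) i = - coord x i" "coord (c *\<^sub>R x) i = c * coord x i"
  by (transfer; simp)+

lemma coord_sum: "coord (\<Sum>j\<in>A. f j) i = (\<Sum>j\<in>A. coord (f j) i)"
  by (induction A rule: infinite_finite_induct) auto

instantiation fvec :: real_inner
begin

definition inner_fvec :: "fvec \<Rightarrow> fvec \<Rightarrow> real" where
  "inner_fvec x y = (\<Sum>i | coord x i \<noteq> 0. coord x i * coord y i)"
definition norm_fvec :: "fvec \<Rightarrow> real" where
  "norm_fvec x = sqrt (inner x x)"
definition sgn_fvec :: "fvec \<Rightarrow> fvec" where
  "sgn_fvec x = x /\<^sub>R norm x"
definition dist_fvec :: "fvec \<Rightarrow> fvec \<Rightarrow> real" where
  "dist_fvec x y = norm (x - y)"
definition uniformity_fvec :: "(fvec \<times> fvec) filter" where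
  "uniformity_fvec = (INF e\<in>{0 <..}. principal {(x, y). dist x y < e})"
definition open_fvec :: "fvec set \<Rightarrow> bool" where
  "open_fvec U \<longleftrightarrow> (\<forall>x\<in>U. eventually (\<lambda>(x', y). x' = x \<longrightarrow> y \<in> U) uniformity)"

text \<open>Vectors with different supports are compared by summing over one common finite index
  set.\<close>

lemma inner_fvec_superset:
  assumes "finite A" "{i. coord x i \<noteq> 0} \<subseteq> A"
  shows "inner x y = (\<Sum>i\<in>A. coord x i * coord y i)"
  unfolding inner_fvec_def using assms by (intro sum.mono_neutral_left) auto

instance
proof
  fix x y z :: fvec and r :: real
  show "dist x y = norm (x - y)" by (rule dist_fvec_def)
  show "sgn x = x /\<^sub>R norm x" by (rule sgn_fvec_def)
  show "uniformity = (INF e\<in>{0 <..}. principal {(x :: fvec, y). dist x y < e})"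
    by (rule uniformity_fvec_def)
  show "open U \<longleftrightarrow> (\<forall>x\<in>U. eventually (\<lambda>(x', y). x' = x \<longrightarrow> y \<in> U) uniformity)" for U :: "fvec set"
    by (rule open_fvec_def)
  let ?A = "{i. coord x i \<noteq> 0} \<union> {i. coord y i \<noteq> 0}"
  have A: "finite ?A" using finite_coord by blast
  have x: "inner x w = (\<Sum>i\<in>?A. coord x i * coord w i)" for w
    by (rule inner_fvec_superset[OF A]) auto
  have y: "inner y w = (\<Sum>i\<in>?A. coord y i * coord w i)" for w
    by (rule inner_fvec_superset[OF A]) auto
  have xy: "inner (x + y) w = (\<Sum>i\<in>?A. coord (x + y) i * coord w i)" for w
    by (rule inner_fvec_superset[OF A]) auto
  have rx: "inner (r *\<^sub>R x) w = (\<Sum>i\<in>?A. coord (r *\<^sub>R x) i * coord w i)" for w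
    by (rule inner_fvec_superset[OF A]) auto
  show "inner x y = inner y x" by (simp add: x y mult.commute)
  show "inner (x + y) z = inner x z + inner y z"
    by (simp add: x y xy sum.distrib distrib_right)
  show "inner (r *\<^sub>R x) y = r * inner x y"
    by (simp add: rx x sum_distrib_left mult.assoc)
  show "0 \<le> inner x x" unfolding inner_fvec_def by (intro sum_nonneg) simp
  have "inner x x = 0 \<longleftrightarrow> {i. coord x i \<noteq> 0} = {}"
    unfolding inner_fvec_def using finite_coord[of x] by (subst sum_nonneg_eq_0_iff) auto
  then show "inner x x = 0 \<longleftrightarrow> x = 0"
    by (auto intro: fvec_eqI)
  show "norm x = sqrt (inner x x)" by (rule norm_fvec_def)
qed

end

section \<open>The embedding of coordinate vectors\<close>

definition fvec_of :: "real vec \<Rightarrow> fvec" where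
  "fvec_of v = Fvec (\<lambda>i. if i < dim_vec v then v $ i else 0)"

definition vec_of :: "nat \<Rightarrow> fvec \<Rightarrow> real vec" where
  "vec_of n x = vec n (coord x)"

lemma coord_fvec_of: "coord (fvec_of v) i = (if i < dim_vec v then v $ i else 0)"
  unfolding fvec_of_def by (subst Fvec_inverse) (auto intro: finite_subset[of _ "{..<dim_vec v}"])

lemma vec_of_carrier [simp]: "vec_of n x \<in> carrier_vec n"
  by (simp add: vec_of_def)

lemma vec_of_fvec_of [simp]: "v \<in> carrier_vec n \<Longrightarrow> vec_of n (fvec_of v) = v"
  by (auto simp: vec_of_def coord_fvec_of)

lemma inj_on_fvec_of: "inj_on fvec_of (carrier_vec n)"
  by (rule inj_on_inverseI[of _ "vec_of n"]) simp

lemma fvec_of_add: "v \<in> carrier_vec n \<Longrightarrow> w \<in> carrier_vec n \<Longrightarrow> fvec_of (v + w) = fvec_of v + fvec_of w"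
  by (rule fvec_eqI) (auto simp: coord_fvec_of)

lemma fvec_of_smult: "fvec_of (c \<cdot>\<^sub>v v) = c *\<^sub>R fvec_of v"
  by (rule fvec_eqI) (auto simp: coord_fvec_of)

lemma fvec_of_zero [simp]: "fvec_of (0\<^sub>v n) = 0"
  by (rule fvec_eqI) (auto simp: coord_fvec_of)

lemma vec_of_add: "vec_of n (x + y) = vec_of n x + vec_of n y"
  by (auto simp: vec_of_def)

lemma vec_of_scaleR: "vec_of n (c *\<^sub>R x) = c \<cdot>\<^sub>v vec_of n x"
  by (auto simp: vec_of_def)

lemma eucl_norm_eq: "eucl_norm v = norm (fvec_of v)"
proof -
  have "inner (fvec_of v) (fvec_of v) = (\<Sum>i<dim_vec v. coord (fvec_of v) i * coord (fvec_of v) i)"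
    by (rule inner_fvec_superset) (auto simp: coord_fvec_of)
  also have "\<dots> = scalar_prod v v"
    by (simp add: scalar_prod_def coord_fvec_of atLeast0LessThan)
  finally show ?thesis by (simp add: eucl_norm_def norm_eq_sqrt_inner)
qed

text \<open>The image of \<open>carrier_vec n\<close> under \<open>fvec_of\<close>, where
  \<open>vec_of n\<close> is the inverse.\<close>

definition fvecs :: "nat \<Rightarrow> fvec set" where
  "fvecs n = {x. \<forall>i\<ge>n. coord x i = 0}"

lemma fvec_of_vec_of [simp]: "x \<in> fvecs n \<Longrightarrow> fvec_of (vec_of n x) = x"
  by (rule fvec_eqI) (auto simp: coord_fvec_of vec_of_def fvecs_def)

lemma fvec_of_in_fvecs: "v \<in> carrier_vec n \<Longrightarrow> fvec_of v \<in> fvecs n"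
  by (auto simp: fvecs_def coord_fvec_of)

lemma subspace_fvecs: "real_vector.subspace (fvecs n)"
  by (auto simp: real_vector.subspace_def fvecs_def)

lemma span_subset_fvecs: "A \<subseteq> fvecs n \<Longrightarrow> span A \<subseteq> fvecs n"
  using subspace_fvecs by (intro span_minimal) auto

lemma fvecs_axis_expansion:
  assumes "x \<in> fvecs n"
  shows "x = (\<Sum>i<n. coord x i *\<^sub>R fvec_of (unit_vec n i))"
proof (rule fvec_eqI)
  fix j
  have "(\<Sum>i<n. coord x i * coord (fvec_of (unit_vec n i)) j) = (\<Sum>i<n. if i = j then coord x j else 0)"
    by (rule sum.cong) (auto simp: coord_fvec_of unit_vec_def)
  then show "coord x j = coord (\<Sum>i<n. coord x i *\<^sub>R fvec_of (unit_vec n i)) j"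
    using assms by (simp add: coord_sum fvecs_def)
qed

lemma fvecs_subset_span_axes: "\<exists>A. finite A \<and> card A \<le> n \<and> fvecs n \<subseteq> span A"
proof (intro exI conjI subsetI)
  let ?A = "(\<lambda>i. fvec_of (unit_vec n i)) ` {..<n}"
  show "finite ?A" by simp
  show "card ?A \<le> n" using card_image_le[of "{..<n}"] by simp
  fix x assume x: "x \<in> fvecs n"
  have "x = (\<Sum>i<n. coord x i *\<^sub>R fvec_of (unit_vec n i))"
    by (rule fvecs_axis_expansion[OF x])
  also have "\<dots> \<in> span ?A"
    by (intro span_sum span_scale span_base) auto
  finally show "x \<in> span ?A" .
qed

lemma independent_card_le: "independent B \<Longrightarrow> B \<subseteq> fvecs n \<Longrightarrow> finite B \<and> card B \<le> n"
  using fvecs_subset_span_axes[of n] independent_span_bound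
  by (metis order_trans subset_trans)

lemma independent_spans_fvecs:
  assumes "independent B" "B \<subseteq> fvecs n" "card B = n"
  shows "fvecs n = span B"
proof (rule ccontr)
  assume "fvecs n \<noteq> span B"
  then obtain x where x: "x \<in> fvecs n" "x \<notin> span B"
    using span_subset_fvecs[OF assms(2)] by blast
  then have "independent (insert x B)" using assms(1) by (simp add: independent_insertI)
  then have "card (insert x B) \<le> n" "finite B"
    using independent_card_le[of "insert x B" n] x assms(2) by auto
  moreover have "x \<notin> B" using x span_base by auto
  ultimately show False using assms(3) by simp
qed

text \<open>On both sides dependence is a vanishing nontrivial combination over a finite set;
  coefficient functions are carried over along the injection \<open>fvec_of\<close>.\<close>

lemma lin_indpt_vec_iff:
  assumes "finite S" "S \<subseteq> carrier_vec n"
  shows "lin_indpt_vec n S \<longleftrightarrow> independent (fvec_of ` S)"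
proof -
  interpret V: vec_space "TYPE(real)" n .
  have inj: "inj_on fvec_of S" using inj_on_fvec_of assms(2) inj_on_subset by blast
  have lc: "fvec_of (V.lincomb a S) = (\<Sum>v\<in>S. a v *\<^sub>R fvec_of v)" for a
  proof (rule fvec_eqI)
    fix i
    have dim: "dim_vec (V.lincomb a S) = n" using V.lincomb_dim assms by auto
    have "coord (a v *\<^sub>R fvec_of v) i = (if i < n then a v * v $ i else 0)" if "v \<in> S" for v
      using that assms(2) by (auto simp: coord_fvec_of)
    then have "coord (\<Sum>v\<in>S. a v *\<^sub>R fvec_of v) i = (if i < n then \<Sum>v\<in>S. a v * v $ i else 0)"
      by (simp only: coord_sum) auto
    then show "coord (fvec_of (V.lincomb a S)) i = coord (\<Sum>v\<in>S. a v *\<^sub>R fvec_of v) i"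
      using V.lincomb_index[OF _ assms(2), of i a] by (simp only: coord_fvec_of dim split: if_split) blast
  qed
  have zero: "V.lincomb a S = 0\<^sub>v n \<longleftrightarrow> (\<Sum>v\<in>S. a v *\<^sub>R fvec_of v) = 0" for a
  proof -
    have "V.lincomb a S \<in> carrier_vec n" using V.lincomb_dim assms by auto
    then have "V.lincomb a S = 0\<^sub>v n \<longleftrightarrow> fvec_of (V.lincomb a S) = fvec_of (0\<^sub>v n)"
      using inj_on_eq_iff[OF inj_on_fvec_of[of n], of "V.lincomb a S" "0\<^sub>v n"] by simp
    then show ?thesis by (simp add: lc)
  qed
  have "V.lin_dep S \<longleftrightarrow> (\<exists>a. V.lincomb a S = 0\<^sub>v n \<and> (\<exists>v\<in>S. a v \<noteq> 0))"
    using V.lin_dep_crit[OF assms(1)] V.finite_lin_indpt2[OF assms] by (auto simp: class_ring_simps)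
  also have "\<dots> \<longleftrightarrow> (\<exists>a. (\<exists>v\<in>S. a v \<noteq> 0) \<and> (\<Sum>v\<in>S. a v *\<^sub>R fvec_of v) = 0)"
    unfolding zero by blast
  also have "\<dots> \<longleftrightarrow> (\<exists>u. (\<exists>w\<in>fvec_of ` S. u w \<noteq> 0) \<and> (\<Sum>w\<in>fvec_of ` S. u w *\<^sub>R w) = 0)"
  proof
    assume "\<exists>a. (\<exists>v\<in>S. a v \<noteq> 0) \<and> (\<Sum>v\<in>S. a v *\<^sub>R fvec_of v) = 0"
    then obtain a where a: "\<exists>v\<in>S. a v \<noteq> 0" "(\<Sum>v\<in>S. a v *\<^sub>R fvec_of v) = 0" by blast
    let ?u = "a \<circ> the_inv_into S fvec_of"
    have u: "?u (fvec_of v) = a v" if "v \<in> S" for v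
      using that by (simp add: the_inv_into_f_f[OF inj])
    have "(\<Sum>w\<in>fvec_of ` S. ?u w *\<^sub>R w) = (\<Sum>v\<in>S. ?u (fvec_of v) *\<^sub>R fvec_of v)"
      by (subst sum.reindex[OF inj]) simp
    also have "\<dots> = (\<Sum>v\<in>S. a v *\<^sub>R fvec_of v)"
      by (rule sum.cong[OF refl]) (simp only: u)
    finally have "(\<Sum>w\<in>fvec_of ` S. ?u w *\<^sub>R w) = 0" using a by simp
    moreover obtain v where "v \<in> S" "a v \<noteq> 0" using a(1) by blast
    then have "fvec_of v \<in> fvec_of ` S" "?u (fvec_of v) \<noteq> 0" using u by simp_all
    ultimately show "\<exists>u. (\<exists>w\<in>fvec_of ` S. u w \<noteq> 0) \<and> (\<Sum>w\<in>fvec_of ` S. u w *\<^sub>R w) = 0"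
      by (intro exI[of _ ?u] conjI bexI[of _ "fvec_of v"])
  next
    assume "\<exists>u. (\<exists>w\<in>fvec_of ` S. u w \<noteq> 0) \<and> (\<Sum>w\<in>fvec_of ` S. u w *\<^sub>R w) = 0"
    then obtain u where "\<exists>w\<in>fvec_of ` S. u w \<noteq> 0" "(\<Sum>w\<in>fvec_of ` S. u w *\<^sub>R w) = 0" by blast
    then show "\<exists>a. (\<exists>v\<in>S. a v \<noteq> 0) \<and> (\<Sum>v\<in>S. a v *\<^sub>R fvec_of v) = 0"
      by (intro exI[of _ "u \<circ> fvec_of"]) (auto simp: sum.reindex[OF inj])
  qed
  also have "\<dots> \<longleftrightarrow> dependent (fvec_of ` S)"
    using dependent_finite[of "fvec_of ` S"] assms(1) by auto
  finally show ?thesis by simp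
qed

lemma fvec_of_lattice_of:
  assumes "set bs \<subseteq> carrier_vec n"
  shows "fvec_of ` vec_module.lattice_of n bs = int_span (map fvec_of bs)"
    and "vec_module.lattice_of n bs \<subseteq> carrier_vec n"
proof -
  interpret V: vec_module "TYPE(real)" n .
  have sl: "fvec_of (V.sumlist (map f xs)) = (\<Sum>i\<leftarrow>xs. fvec_of (f i)) \<and> V.sumlist (map f xs) \<in> carrier_vec n"
    if "\<forall>i\<in>set xs. f i \<in> carrier_vec n" for xs :: "nat list" and f
    using that by (induction xs) (auto simp: fvec_of_add)
  have mem: "\<forall>i\<in>set [0..<length bs]. of_int (c i) \<cdot>\<^sub>v bs ! i \<in> carrier_vec n" for c :: "nat \<Rightarrow> int"
    using assms by auto
  show "vec_module.lattice_of n bs \<subseteq> carrier_vec n"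
    unfolding V.lattice_of_def using sl[OF mem] by auto
  have "fvec_of (V.sumlist (map (\<lambda>i. of_int (c i) \<cdot>\<^sub>v bs ! i) [0..<length bs]))
      = (\<Sum>i<length (map fvec_of bs). of_int (c i) *\<^sub>R map fvec_of bs ! i)" for c :: "nat \<Rightarrow> int"
    using sl[OF mem] by (simp add: interv_sum_list_conv_sum_set_nat atLeast0LessThan fvec_of_smult)
  then show "fvec_of ` vec_module.lattice_of n bs = int_span (map fvec_of bs)"
    unfolding V.lattice_of_def int_span_conv_sum image_image by simp
qed

lemma full_rank_latticeE:
  assumes "full_rank_lattice n L"
  obtains bs where "length bs = n" "has_dual bs" "fvec_of ` L = int_span bs" "L \<subseteq> carrier_vec n"
    "fvecs n = span (set bs)"
proof -
  obtain vs where vs: "length vs = n" "distinct vs" "set vs \<subseteq> carrier_vec n" "lin_indpt_vec n (set vs)"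
      "L = vec_module.lattice_of n vs"
    using assms by (auto simp: full_rank_lattice_def)
  have ind: "independent (set (map fvec_of vs))"
    using vs lin_indpt_vec_iff[of "set vs" n] by simp
  have dist: "distinct (map fvec_of vs)"
    using vs inj_on_subset[OF inj_on_fvec_of vs(3)] by (simp add: distinct_map)
  show thesis
  proof
    show "length (map fvec_of vs) = n" using vs by simp
    show "has_dual (map fvec_of vs)" by (rule independent_has_dual[OF dist ind])
    show "fvec_of ` L = int_span (map fvec_of vs)" "L \<subseteq> carrier_vec n"
      using fvec_of_lattice_of[OF vs(3)] vs by auto
    show "fvecs n = span (set (map fvec_of vs))"
      using vs distinct_card[OF dist] by (intro independent_spans_fvecs[OF ind]) (auto simp: fvec_of_in_fvecs)
  qed
qed

lemma full_rank_lattice_carrier: "full_rank_lattice n L \<Longrightarrow> L \<subseteq> carrier_vec n"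
  by (erule full_rank_latticeE)

lemma abs_coord_le_norm: "\<bar>coord x i\<bar> \<le> norm x"
proof (cases "coord x i = 0")
  case False
  then have "coord x i * coord x i \<le> inner x x"
    unfolding inner_fvec_def using finite_coord[of x]
    by (intro member_le_sum[of i _ "\<lambda>i. coord x i * coord x i"]) auto
  then have "sqrt (coord x i * coord x i) \<le> norm x"
    unfolding norm_eq_sqrt_inner by (simp only: real_sqrt_le_iff)
  then show ?thesis by simp
qed simp

section \<open>Successive minima and distortion\<close>

lemma linear_map_vecI:
  assumes "\<And>x. x \<in> carrier_vec n \<Longrightarrow> T x \<in> carrier_vec n"
    and "\<And>x y. x \<in> carrier_vec n \<Longrightarrow> y \<in> carrier_vec n \<Longrightarrow> T (x + y) = T x + T y"
    and "\<And>c x. x \<in> carrier_vec n \<Longrightarrow> T (c \<cdot>\<^sub>v x) = c \<cdot>\<^sub>v T x"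
  shows "linear_map_vec n T"
proof -
  interpret V: vec_space "TYPE(real)" n .
  show ?thesis
    unfolding linear_map_def mod_hom_def mod_hom_axioms_def LinearCombinations.module_hom_def
    using assms V.vectorspace_axioms V.module_axioms by (auto simp: module_vec_simps)
qed

lemma linear_map_vecD:
  assumes "linear_map_vec n T"
  shows "x \<in> carrier_vec n \<Longrightarrow> T x \<in> carrier_vec n"
    and "x \<in> carrier_vec n \<Longrightarrow> y \<in> carrier_vec n \<Longrightarrow> T (x + y) = T x + T y"
    and "x \<in> carrier_vec n \<Longrightarrow> T (c \<cdot>\<^sub>v x) = c \<cdot>\<^sub>v T x"
proof -
  have "T \<in> LinearCombinations.module_hom (class_ring :: real ring) (module_vec TYPE(real) n) (module_vec TYPE(real) n)"
    using assms unfolding linear_map_def mod_hom_def mod_hom_axioms_def by blast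
  then show "x \<in> carrier_vec n \<Longrightarrow> T x \<in> carrier_vec n"
    and "x \<in> carrier_vec n \<Longrightarrow> y \<in> carrier_vec n \<Longrightarrow> T (x + y) = T x + T y"
    and "x \<in> carrier_vec n \<Longrightarrow> T (c \<cdot>\<^sub>v x) = c \<cdot>\<^sub>v T x"
    by (auto simp: LinearCombinations.module_hom_def module_vec_simps class_ring_simps)
qed

text \<open>Truncation to the first \<open>n\<close> coordinates before \<open>T\<close> makes this
  linear on the whole type, as facts about \<open>linear\<close> demand.\<close>

definition fvec_map :: "nat \<Rightarrow> (real vec \<Rightarrow> real vec) \<Rightarrow> fvec \<Rightarrow> fvec" where
  "fvec_map n T x = fvec_of (T (vec_of n x))"

lemma linear_fvec_map:
  assumes "linear_map_vec n T"
  shows "linear (fvec_map n T)"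
  using linear_map_vecD[OF assms]
  by (intro linearI)
    (simp_all add: fvec_map_def vec_of_add vec_of_scaleR fvec_of_smult fvec_of_add[of _ n])

lemma fvec_map_fvec_of [simp]: "v \<in> carrier_vec n \<Longrightarrow> fvec_map n T (fvec_of v) = fvec_of (T v)"
  by (simp add: fvec_map_def)

lemma eucl_norm_smult: "eucl_norm (c \<cdot>\<^sub>v v) = \<bar>c\<bar> * eucl_norm v"
  by (simp add: eucl_norm_eq fvec_of_smult)

lemma op_norm_le:
  assumes "0 < n" "\<And>x. x \<in> carrier_vec n \<Longrightarrow> eucl_norm (f x) \<le> K * eucl_norm x"
  shows "op_norm n f \<le> K"
  unfolding op_norm_def
proof (rule cSUP_least)
  have "unit_vec n 0 \<in> {x \<in> carrier_vec n. eucl_norm x = 1}"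
    using assms(1) by (simp add: eucl_norm_def)
  then show "{x \<in> carrier_vec n. eucl_norm x = 1} \<noteq> {}" by blast
qed (use assms(2) in fastforce)

text \<open>A supremum of reals is an upper bound only for a set known to be bounded. Coordinates of
  a unit vector are at most 1, so the images of the axes supply a bound; scaling does the
  rest.\<close>

lemma eucl_norm_le_op_norm:
  assumes T: "linear_map_vec n T" and x: "x \<in> carrier_vec n"
  shows "eucl_norm (T x) \<le> op_norm n T * eucl_norm x"
proof -
  let ?U = "{x \<in> carrier_vec n. eucl_norm x = 1}"
  let ?e = "\<lambda>i. fvec_of (unit_vec n i)"
  interpret F: linear "fvec_map n T" using linear_fvec_map[OF T] .
  have "eucl_norm (T u) \<le> (\<Sum>i<n. norm (fvec_map n T (?e i)))" if u: "u \<in> ?U" for u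
  proof -
    have "fvec_of u = (\<Sum>i<n. coord (fvec_of u) i *\<^sub>R ?e i)"
      using u by (intro fvecs_axis_expansion fvec_of_in_fvecs) auto
    then have "fvec_map n T (fvec_of u) = (\<Sum>i<n. coord (fvec_of u) i *\<^sub>R fvec_map n T (?e i))"
      by (metis (no_types, lifting) F.scale F.sum sum.cong)
    then have "eucl_norm (T u) = norm (\<Sum>i<n. coord (fvec_of u) i *\<^sub>R fvec_map n T (?e i))"
      using u by (simp add: eucl_norm_eq)
    also have "\<dots> \<le> (\<Sum>i<n. norm (coord (fvec_of u) i *\<^sub>R fvec_map n T (?e i)))"
      by (rule norm_sum)
    also have "\<dots> \<le> (\<Sum>i<n. norm (fvec_map n T (?e i)))"
    proof (rule sum_mono)
      fix i
      have "\<bar>coord (fvec_of u) i\<bar> \<le> 1"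
        using abs_coord_le_norm[of "fvec_of u" i] u by (simp add: eucl_norm_eq)
      then show "norm (coord (fvec_of u) i *\<^sub>R fvec_map n T (?e i)) \<le> norm (fvec_map n T (?e i))"
        using mult_right_mono[of "\<bar>coord (fvec_of u) i\<bar>" 1 "norm (fvec_map n T (?e i))"] by simp
    qed
    finally show ?thesis .
  qed
  then have bdd: "bdd_above ((\<lambda>x. eucl_norm (T x)) ` ?U)" by (rule bdd_aboveI2)
  show ?thesis
  proof (cases "eucl_norm x = 0")
    case True
    then have "fvec_of x = fvec_of (0\<^sub>v n)" by (simp add: eucl_norm_eq)
    then have "fvec_of (T x) = 0" using fvec_map_fvec_of[OF x, of T] F.zero by simp
    then show ?thesis using True by (simp add: eucl_norm_eq)
  next
    case False
    then have pos: "0 < eucl_norm x" by (simp add: eucl_norm_eq)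
    let ?u = "(1 / eucl_norm x) \<cdot>\<^sub>v x"
    have u: "?u \<in> ?U" using x pos by (simp add: eucl_norm_smult)
    have "eucl_norm (T ?u) \<le> op_norm n T"
      unfolding op_norm_def by (rule cSUP_upper[OF u bdd])
    moreover have "eucl_norm (T ?u) = eucl_norm (T x) / eucl_norm x"
      using x pos by (simp add: linear_map_vecD(3)[OF T] eucl_norm_smult)
    ultimately show ?thesis using pos by (simp add: field_simps)
  qed
qed

section \<open>Successive minima as attained values\<close>

definition has_indep_le :: "'a::real_normed_vector set \<Rightarrow> nat \<Rightarrow> real \<Rightarrow> bool" where
  "has_indep_le L i r \<longleftrightarrow> (\<exists>A. A \<subseteq> L \<and> finite A \<and> card A = i \<and> independent A \<and> (\<forall>v\<in>A. norm v \<le> r))"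

lemma succ_min_eq:
  assumes "L \<subseteq> carrier_vec n"
  shows "succ_min n i L = (LEAST r. 0 < r \<and> has_indep_le (fvec_of ` L) i r)"
proof -
  have "(\<exists>S. S \<subseteq> L \<and> finite S \<and> card S = i \<and> lin_indpt_vec n S \<and> (\<forall>v\<in>S. eucl_norm v \<le> r))
      \<longleftrightarrow> has_indep_le (fvec_of ` L) i r" for r
  proof
    assume "\<exists>S. S \<subseteq> L \<and> finite S \<and> card S = i \<and> lin_indpt_vec n S \<and> (\<forall>v\<in>S. eucl_norm v \<le> r)"
    then obtain S where S: "S \<subseteq> L" "finite S" "card S = i" "lin_indpt_vec n S" "\<forall>v\<in>S. eucl_norm v \<le> r"
      by blast
    have "S \<subseteq> carrier_vec n" using S assms by blast
    then have "independent (fvec_of ` S)" "card (fvec_of ` S) = i"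
      using S lin_indpt_vec_iff card_image[OF inj_on_subset[OF inj_on_fvec_of]] by auto
    then show "has_indep_le (fvec_of ` L) i r"
      unfolding has_indep_le_def using S by (intro exI[of _ "fvec_of ` S"]) (auto simp: eucl_norm_eq)
  next
    assume "has_indep_le (fvec_of ` L) i r"
    then obtain A where A: "A \<subseteq> fvec_of ` L" "finite A" "card A = i" "independent A" "\<forall>v\<in>A. norm v \<le> r"
      by (auto simp: has_indep_le_def)
    then obtain S where S: "S \<subseteq> L" "A = fvec_of ` S" by (auto simp: subset_image_iff)
    have "S \<subseteq> carrier_vec n" using S assms by blast
    then have inj: "inj_on fvec_of S" using inj_on_subset[OF inj_on_fvec_of] by blast
    then have "finite S" "card S = i" using A S by (auto simp: finite_image_iff card_image)
    then show "\<exists>S. S \<subseteq> L \<and> finite S \<and> card S = i \<and> lin_indpt_vec n S \<and> (\<forall>v\<in>S. eucl_norm v \<le> r)"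
      using A S \<open>S \<subseteq> carrier_vec n\<close> lin_indpt_vec_iff[of S n]
      by (intro exI[of _ S]) (auto simp: eucl_norm_eq)
  qed
  then show ?thesis by (simp add: succ_min_def)
qed

lemma dual_basis_take_independent:
  assumes "dual_basis cs ds" "i \<le> length cs"
  shows "independent (set (take i cs))" "card (set (take i cs)) = i"
  using independent_mono[OF dual_basis_independent[OF assms(1)] set_take_subset]
    distinct_card[OF distinct_take[OF dual_basis_distinct[OF assms(1)]], of i] assms(2) by auto

text \<open>With \<open>R\<close> large enough for the first \<open>i\<close> basis vectors, only
  finitely many independent sets lie in the ball of radius \<open>R\<close>; one with the least
  maximal norm gives the minimum. Radii above \<open>R\<close> cannot do better.\<close>

lemma ex_least_has_indep_le:
  assumes dual: "dual_basis bs ds" and i: "0 < i" "i \<le> length bs"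
  shows "\<exists>r. 0 < r \<and> has_indep_le (int_span bs) i r \<and> (\<forall>r'. has_indep_le (int_span bs) i r' \<longrightarrow> r \<le> r')"
proof -
  let ?A0 = "set (take i bs)"
  define R where "R = Max (norm ` ?A0)"
  define AA where "AA = {A. A \<subseteq> {v \<in> int_span bs. norm v \<le> R} \<and> card A = i \<and> independent A}"
  have fin: "finite {v \<in> int_span bs. norm v \<le> R}"
    using finite_int_span_ball dual by (auto simp: has_dual_def)
  then have "finite AA"
    by (intro finite_subset[of AA "Pow {v \<in> int_span bs. norm v \<le> R}"]) (auto simp: AA_def)
  have "?A0 \<subseteq> {v \<in> int_span bs. norm v \<le> R}"
    using int_span_base set_take_subset[of i bs] by (auto simp: R_def intro!: Max_ge)
  then have "?A0 \<in> AA"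
    using dual_basis_take_independent[OF dual i(2)] by (auto simp: AA_def)
  let ?m = "\<lambda>A. Max (norm ` A)"
  define A where "A = arg_min_on ?m AA"
  have A: "A \<in> AA" "\<And>B. B \<in> AA \<Longrightarrow> ?m A \<le> ?m B"
    unfolding A_def using arg_min_if_finite(1)[OF \<open>finite AA\<close>, of ?m] arg_min_least[OF \<open>finite AA\<close>, of _ ?m]
      \<open>?A0 \<in> AA\<close> by blast+
  have finA: "finite A" "A \<noteq> {}"
    using A(1) i fin finite_subset by (auto simp: AA_def)
  show ?thesis
  proof (intro exI[of _ "?m A"] conjI allI impI)
    obtain v where "v \<in> A" using finA by blast
    then have "v \<noteq> 0" using A(1) dependent_zero by (auto simp: AA_def)
    then have "0 < norm v" by simp
    also have "norm v \<le> ?m A" using \<open>v \<in> A\<close> finA by (intro Max_ge) auto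
    finally show "0 < ?m A" .
    show "has_indep_le (int_span bs) i (?m A)"
      unfolding has_indep_le_def using A(1) finA by (intro exI[of _ A]) (auto simp: AA_def)
    fix r' assume "has_indep_le (int_span bs) i r'"
    then obtain B where B: "B \<subseteq> int_span bs" "finite B" "card B = i" "independent B" "\<forall>v\<in>B. norm v \<le> r'"
      by (auto simp: has_indep_le_def)
    show "?m A \<le> r'"
    proof (cases "r' \<le> R")
      case True
      with B have "B \<in> AA" by (force simp: AA_def)
      then have "?m A \<le> ?m B" using A by blast
      also have "\<dots> \<le> r'" using B i by (intro Max.boundedI) auto
      finally show ?thesis .
    next
      case False
      then show ?thesis using A(2)[OF \<open>?A0 \<in> AA\<close>] by (simp add: R_def)
    qed
  qed
qed

lemma succ_min_works:
  assumes "full_rank_lattice n L" "0 < i" "i \<le> n"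
  shows "0 < succ_min n i L" "has_indep_le (fvec_of ` L) i (succ_min n i L)"
    and "has_indep_le (fvec_of ` L) i r \<Longrightarrow> succ_min n i L \<le> r"
proof -
  obtain bs where bs: "length bs = n" "has_dual bs" "fvec_of ` L = int_span bs" "L \<subseteq> carrier_vec n"
      "fvecs n = span (set bs)"
    by (rule full_rank_latticeE[OF assms(1)])
  then obtain ds where "dual_basis bs ds" by (auto simp: has_dual_def)
  then obtain r where r: "0 < r" "has_indep_le (fvec_of ` L) i r"
      "\<And>r'. has_indep_le (fvec_of ` L) i r' \<Longrightarrow> r \<le> r'"
    using ex_least_has_indep_le[of bs ds i] assms bs by auto
  have "succ_min n i L = r"
    unfolding succ_min_eq[OF bs(4)] using r by (intro Least_equality) auto
  with r show "0 < succ_min n i L" "has_indep_le (fvec_of ` L) i (succ_min n i L)"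
    and "has_indep_le (fvec_of ` L) i r \<Longrightarrow> succ_min n i L \<le> r" for r
    by auto
qed

lemma ex_well_conditioned_basis:
  assumes L: "full_rank_lattice n L" and n: "2 \<le> n"
  defines "K \<equiv> exp (26 * (ln n)\<^sup>2)"
  shows "\<exists>cs ds. length cs = n \<and> dual_basis cs ds \<and> int_span cs = fvec_of ` L \<and> fvecs n = span (set cs) \<and>
    (\<forall>i<n. norm (cs ! i) \<le> K * succ_min n (Suc i) L \<and> norm (ds ! i) \<le> K / succ_min n (Suc i) L)"
proof -
  obtain bs where bs: "length bs = n" "has_dual bs" "fvec_of ` L = int_span bs" "L \<subseteq> carrier_vec n"
      "fvecs n = span (set bs)"
    by (rule full_rank_latticeE[OF L])
  obtain cs ds where c: "int_span cs = int_span bs" "length cs = n" "dual_basis cs ds"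
      "sorted (map norm cs)" "\<And>i. i < n \<Longrightarrow> norm (cs ! i) * norm (ds ! i) \<le> K"
    using ex_seysen_reduced_basis[OF bs(2,1) n] unfolding K_def by blast
  have "set cs \<subseteq> fvecs n"
    unfolding bs(5) using int_span_base c(1) int_span_subset_span by blast
  then have "fvecs n = span (set cs)"
    using c dual_basis_independent dual_basis_distinct distinct_card by (metis independent_spans_fvecs)
  moreover have "norm (cs ! i) \<le> K * succ_min n (Suc i) L \<and> norm (ds ! i) \<le> K / succ_min n (Suc i) L"
    if i: "i < n" for i
  proof -
    let ?l = "succ_min n (Suc i) L"
    have l: "0 < ?l" "has_indep_le (int_span cs) (Suc i) ?l"
        "\<And>r. has_indep_le (int_span cs) (Suc i) r \<Longrightarrow> ?l \<le> r"
      using succ_min_works[OF L, of "Suc i"] i bs c by auto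
    obtain A where "A \<subseteq> int_span cs" "independent A" "card A = Suc i" "\<And>v. v \<in> A \<Longrightarrow> norm v \<le> ?l"
      using l(2) by (auto simp: has_indep_le_def)
    then have 1: "norm (cs ! i) \<le> K * ?l"
      using independent_lattice_bound[OF c(3,4)] c(2,5) i by blast
    \<comment> \<open>By sorting, the first \<open>i + 1\<close> basis vectors are no longer than
      \<open>cs ! i\<close>, so the minimum is at most this length. The bound on the product of the
      norms then yields the one on \<open>ds ! i\<close>.\<close>
    have "has_indep_le (int_span cs) (Suc i) (norm (cs ! i))"
      unfolding has_indep_le_def
    proof (intro exI[of _ "set (take (Suc i) cs)"] conjI ballI)
      show "set (take (Suc i) cs) \<subseteq> int_span cs"
        using int_span_base set_take_subset by fastforce
      show "card (set (take (Suc i) cs)) = Suc i" "independent (set (take (Suc i) cs))"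
        using dual_basis_take_independent[OF c(3), of "Suc i"] i c by auto
      fix v assume "v \<in> set (take (Suc i) cs)"
      then obtain j where "j \<le> i" "v = cs ! j" using i c by (auto simp: in_set_conv_nth less_Suc_eq_le)
      then show "norm v \<le> norm (cs ! i)" using sorted_nth_mono[OF c(4), of j i] i c by simp
    qed simp
    then have 2: "?l \<le> norm (cs ! i)" by (rule l(3))
    have "?l * norm (ds ! i) \<le> norm (cs ! i) * norm (ds ! i)"
      using 2 by (intro mult_right_mono) auto
    also have "\<dots> \<le> K" using c i by simp
    finally have "norm (ds ! i) \<le> K / ?l" using l(1) by (simp add: field_simps)
    with 1 show ?thesis by blast
  qed
  ultimately show ?thesis using c bs by metis
qed

text \<open>The images of a basis of \<open>L1\<close> generate \<open>L2\<close>, hence span the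
  space. A nonzero kernel vector would express one image by the other \<open>n - 1\<close>, too few
  for \<open>n\<close> dimensions.\<close>

lemma lattice_map_bij_betw:
  assumes T: "linear_map_vec n T" "T ` L1 = L2"
    and L: "full_rank_lattice n L1" "full_rank_lattice n L2"
  shows "bij_betw T (carrier_vec n) (carrier_vec n)"
proof -
  obtain bs where bs: "length bs = n" "has_dual bs" "fvec_of ` L1 = int_span bs" "L1 \<subseteq> carrier_vec n"
      "fvecs n = span (set bs)"
    by (rule full_rank_latticeE[OF L(1)])
  obtain ds where ds: "dual_basis bs ds" using bs(2) by (auto simp: has_dual_def)
  obtain cs where cs: "length cs = n" "has_dual cs" "fvec_of ` L2 = int_span cs" "L2 \<subseteq> carrier_vec n"
      "fvecs n = span (set cs)"
    by (rule full_rank_latticeE[OF L(2)])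
  obtain es where es: "dual_basis cs es" using cs(2) by (auto simp: has_dual_def)
  let ?F = "fvec_map n T"
  have F: "linear ?F" using linear_fvec_map[OF T(1)] .
  have im: "?F ` int_span bs = int_span cs"
  proof -
    have "?F ` int_span bs = (\<lambda>v. fvec_of (T v)) ` L1"
      unfolding bs(3)[symmetric] image_image using bs(4) by (intro image_cong) auto
    then show ?thesis using T(2) cs(3) by auto
  qed
  then have map: "int_span (map ?F bs) = int_span cs" using int_span_map[OF F] by simp
  have sub: "fvecs n \<subseteq> span (set (map ?F bs))"
    unfolding cs(5) using map int_span_base int_span_subset_span by (intro span_minimal) blast+
  have ker: "x = 0" if x: "x \<in> fvecs n" "?F x = 0" for x
  proof (rule ccontr)
    assume "x \<noteq> 0"
    have exp: "x = (\<Sum>i<n. inner x (ds ! i) *\<^sub>R bs ! i)"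
      using span_eq_sum_dual[OF ds, of x] x bs by simp
    obtain k where k: "k < n" "inner x (ds ! k) \<noteq> 0"
    proof (rule ccontr)
      assume "\<not> thesis"
      then have "\<forall>i<n. inner x (ds ! i) = 0" using that by blast
      then have "x = 0" using exp by simp
      then show False using \<open>x \<noteq> 0\<close> by blast
    qed
    let ?B = "(\<lambda>i. ?F (bs ! i)) ` ({..<n} - {k})"
    have "0 = ?F (\<Sum>i<n. inner x (ds ! i) *\<^sub>R bs ! i)" using x exp by simp
    also have "\<dots> = (\<Sum>i<n. inner x (ds ! i) *\<^sub>R ?F (bs ! i))"
      by (simp add: linear_sum[OF F] linear_scale[OF F])
    also have "\<dots> = inner x (ds ! k) *\<^sub>R ?F (bs ! k) + (\<Sum>i\<in>{..<n} - {k}. inner x (ds ! i) *\<^sub>R ?F (bs ! i))"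
      using k by (intro sum.remove) auto
    finally have "inner x (ds ! k) *\<^sub>R ?F (bs ! k) = - (\<Sum>i\<in>{..<n} - {k}. inner x (ds ! i) *\<^sub>R ?F (bs ! i))"
      by (simp add: eq_neg_iff_add_eq_0)
    also have "\<dots> \<in> span ?B"
      by (intro span_neg span_sum span_scale span_base) auto
    finally have "(1 / inner x (ds ! k)) *\<^sub>R (inner x (ds ! k) *\<^sub>R ?F (bs ! k)) \<in> span ?B"
      by (rule span_scale)
    then have "?F (bs ! k) \<in> span ?B" using k by simp
    then have "?F (bs ! i) \<in> span ?B" if "i < n" for i
      using that by (cases "i = k") (auto intro: span_base)
    then have "set (map ?F bs) \<subseteq> span ?B" using bs(1) by (auto simp: in_set_conv_nth)
    then have "span (set (map ?F bs)) \<subseteq> span ?B" by (intro span_minimal) auto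
    then have "span (set cs) \<subseteq> span ?B" using sub cs(5) by simp
    then have "set cs \<subseteq> span ?B" using span_superset[of "set cs"] by (rule order_trans[rotated])
    then have "card (set cs) \<le> card ?B"
      using independent_span_bound[OF _ dual_basis_independent[OF es]] by simp
    also have "\<dots> \<le> card ({..<n} - {k})" by (intro card_image_le) simp
    finally show False
      using distinct_card[OF dual_basis_distinct[OF es]] cs(1) k by simp
  qed
  have "inj_on T (carrier_vec n)"
  proof (rule inj_onI)
    fix x y assume xy: "x \<in> carrier_vec n" "y \<in> carrier_vec n" "T x = T y"
    then have "?F (fvec_of x) = ?F (fvec_of y)" by simp
    then have "?F (fvec_of x - fvec_of y) = 0" by (simp add: linear_diff[OF F])
    moreover have "fvec_of x - fvec_of y \<in> fvecs n"
      using xy fvec_of_in_fvecs[of x n] fvec_of_in_fvecs[of y n] by (auto simp: fvecs_def)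
    ultimately have "fvec_of x = fvec_of y" using ker[of "fvec_of x - fvec_of y"] by simp
    then show "x = y" using xy inj_on_fvec_of[of n] by (auto simp: inj_on_def)
  qed
  moreover have "T ` carrier_vec n = (carrier_vec n :: real vec set)"
  proof (intro equalityI subsetI)
    fix y :: "real vec" assume y: "y \<in> carrier_vec n"
    have "fvec_of y \<in> ?F ` span (set bs)"
      using sub fvec_of_in_fvecs[OF y] linear_span_image[OF F, of "set bs"] by auto
    then obtain x where x: "x \<in> fvecs n" "fvec_of y = ?F x" unfolding image_iff bs(5) by blast
    then have "y = T (vec_of n x)"
      using y inj_on_fvec_of[of n] linear_map_vecD(1)[OF T(1)] by (auto simp: inj_on_def fvec_map_def)
    then show "y \<in> T ` carrier_vec n" by auto
  qed (use linear_map_vecD(1)[OF T(1)] in auto)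
  ultimately show ?thesis by (simp add: bij_betw_def)
qed

lemma inv_lattice_map:
  assumes T: "linear_map_vec n T" "T ` L1 = L2" and bij: "bij_betw T (carrier_vec n) (carrier_vec n)"
    and L1: "L1 \<subseteq> carrier_vec n"
  defines "G \<equiv> inv_into (carrier_vec n) T"
  shows "linear_map_vec n G" "G ` L2 = L1" "bij_betw G (carrier_vec n) (carrier_vec n)"
proof -
  have inj: "inj_on T (carrier_vec n)" and im: "T ` carrier_vec n = carrier_vec n"
    using bij by (auto simp: bij_betw_def)
  have GT: "G (T x) = x" if "x \<in> carrier_vec n" for x
    unfolding G_def using inv_into_f_f[OF inj that] .
  show Gb: "bij_betw G (carrier_vec n) (carrier_vec n)"
    unfolding G_def by (rule bij_betw_inv_into[OF bij])
  show "G ` L2 = L1"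
    unfolding T(2)[symmetric] image_image using L1 GT by (force simp: image_iff)
  show "linear_map_vec n G"
  proof (rule linear_map_vecI)
    fix x y :: "real vec" assume "x \<in> carrier_vec n" "y \<in> carrier_vec n"
    then have "x \<in> T ` carrier_vec n" "y \<in> T ` carrier_vec n" by (simp_all only: im)
    then obtain u v where uv: "u \<in> carrier_vec n" "v \<in> carrier_vec n" "x = T u" "y = T v"
      unfolding image_iff by blast
    show "G (x + y) = G x + G y"
      using uv GT by (simp flip: linear_map_vecD(2)[OF T(1)])
  next
    fix x :: "real vec" and c :: real assume "x \<in> carrier_vec n"
    then have "x \<in> T ` carrier_vec n" by (simp only: im)
    then obtain u where u: "u \<in> carrier_vec n" "x = T u" unfolding image_iff by blast
    then show "G (c \<cdot>\<^sub>v x) = c \<cdot>\<^sub>v G x"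
      using GT by (simp flip: linear_map_vecD(3)[OF T(1)])
  qed (use Gb in \<open>auto simp: bij_betw_def\<close>)
qed

section \<open>The lower bound for the condition number\<close>

lemma succ_min_le_op_norm:
  assumes T: "linear_map_vec n T" "T ` L1 = L2" "inj_on T (carrier_vec n)"
    and L: "full_rank_lattice n L1" "full_rank_lattice n L2" and i: "0 < i" "i \<le> n"
  shows "succ_min n i L2 \<le> op_norm n T * succ_min n i L1"
proof -
  let ?F = "fvec_map n T"
  have F: "linear ?F" using linear_fvec_map[OF T(1)] .
  note L1 = full_rank_lattice_carrier[OF L(1)]
  obtain A where A: "A \<subseteq> fvec_of ` L1" "finite A" "card A = i" "independent A" "\<And>v. v \<in> A \<Longrightarrow> norm v \<le> succ_min n i L1"
    using succ_min_works(2)[OF L(1) i] by (auto simp: has_indep_le_def)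
  have "A \<subseteq> fvecs n" using A(1) L1 fvec_of_in_fvecs by blast
  have inj: "inj_on ?F (fvecs n)"
  proof (rule inj_onI)
    fix x y assume "x \<in> fvecs n" "y \<in> fvecs n" "?F x = ?F y"
    then show "x = y"
      using inj_on_fvec_of[of n] T(3) linear_map_vecD(1)[OF T(1)]
      by (metis fvec_map_def fvec_of_vec_of inj_onD vec_of_carrier)
  qed
  have "span A \<subseteq> fvecs n" using span_subset_fvecs[OF \<open>A \<subseteq> fvecs n\<close>] .
  then have "independent (?F ` A)"
    using linear_independent_injective_image[OF F A(4)] inj_on_subset[OF inj] by blast
  moreover have "card (?F ` A) = i"
    using card_image[OF inj_on_subset[OF inj \<open>A \<subseteq> fvecs n\<close>]] A by simp
  moreover have "?F ` A \<subseteq> fvec_of ` L2" using A(1) L1 T(2) by force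
  moreover have "norm v \<le> op_norm n T * succ_min n i L1" if v: "v \<in> ?F ` A" for v
  proof -
    obtain a where a: "a \<in> A" "v = ?F a" using v by blast
    then obtain x where "x \<in> L1" "a = fvec_of x" using A(1) by blast
    with a L1 have x: "x \<in> L1" "fvec_of x \<in> A" "v = fvec_of (T x)" by auto
    then have "norm v \<le> op_norm n T * norm (fvec_of x)"
      using eucl_norm_le_op_norm[OF T(1), of x] L1 by (auto simp: eucl_norm_eq)
    \<comment> \<open>The sign of the supremum is read off from the bound at a nonzero
      vector.\<close>
    moreover have "0 \<le> op_norm n T"
    proof -
      have "fvec_of x \<noteq> 0" using A(4) x(2) dependent_zero by metis
      moreover have "0 \<le> op_norm n T * norm (fvec_of x)"
        using \<open>norm v \<le> _\<close> norm_ge_zero order_trans by blast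
      ultimately show ?thesis by (simp add: zero_le_mult_iff)
    qed
    ultimately show ?thesis
      using A(5)[OF x(2)] mult_left_mono order_trans by blast
  qed
  ultimately have "has_indep_le (fvec_of ` L2) i (op_norm n T * succ_min n i L1)"
    unfolding has_indep_le_def using A(2) by blast
  then show ?thesis by (rule succ_min_works(3)[OF L(2) i])
qed

lemma min_ratio_le_op_norm:
  assumes "linear_map_vec n T" "T ` L1 = L2" "inj_on T (carrier_vec n)"
    and L: "full_rank_lattice n L1" "full_rank_lattice n L2" and n: "0 < n"
  shows "min_ratio n L1 L2 \<le> op_norm n T"
  unfolding min_ratio_def
proof (rule Max.boundedI)
  fix x assume "x \<in> (\<lambda>i. succ_min n i L2 / succ_min n i L1) ` {1..n}"
  then obtain i where "i \<in> {1..n}" and x: "x = succ_min n i L2 / succ_min n i L1" by blast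
  then have i: "0 < i" "i \<le> n" by auto
  show "x \<le> op_norm n T"
    unfolding x using succ_min_le_op_norm[OF assms(1-5) i(1,2)] succ_min_works(1)[OF L(1) i(1,2)]
    by (simp add: field_simps)
qed (use n in auto)

lemma min_ratio_ge:
  assumes "0 < i" "i \<le> n"
  shows "succ_min n i L2 / succ_min n i L1 \<le> min_ratio n L1 L2"
  unfolding min_ratio_def using assms by (intro Max_ge) auto

lemma min_ratio_pos:
  assumes "full_rank_lattice n L1" "full_rank_lattice n L2" "0 < n"
  shows "0 < min_ratio n L1 L2"
proof -
  have "0 < succ_min n 1 L2 / succ_min n 1 L1"
    using succ_min_works(1)[OF assms(1), of 1] succ_min_works(1)[OF assms(2), of 1] assms(3) by simp
  also have "\<dots> \<le> min_ratio n L1 L2" using assms(3) by (intro min_ratio_ge) auto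
  finally show ?thesis .
qed

lemma cond_number_ge:
  assumes T: "linear_map_vec n T" "T ` L1 = L2"
    and L: "full_rank_lattice n L1" "full_rank_lattice n L2" and n: "0 < n"
  shows "min_ratio n L1 L2 \<le> op_norm n T"
    and "min_ratio n L2 L1 \<le> op_norm n (inv_into (carrier_vec n) T)"
proof -
  note L1 = full_rank_lattice_carrier[OF L(1)]
  have bij: "bij_betw T (carrier_vec n) (carrier_vec n)" by (rule lattice_map_bij_betw[OF T L])
  show "min_ratio n L1 L2 \<le> op_norm n T"
    using bij by (intro min_ratio_le_op_norm[OF T _ L n]) (rule bij_betw_imp_inj_on)
  note G = inv_lattice_map[OF T bij L1]
  show "min_ratio n L2 L1 \<le> op_norm n (inv_into (carrier_vec n) T)"
    by (rule min_ratio_le_op_norm[OF G(1,2) bij_betw_imp_inj_on[OF G(3)] L(2,1) n])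
qed

section \<open>Finiteness of the condition numbers below a bound\<close>

lemma op_norm_cong:
  "(\<And>x. x \<in> carrier_vec n \<Longrightarrow> f x = g x) \<Longrightarrow> op_norm n f = op_norm n g"
  unfolding op_norm_def by (intro SUP_cong) auto

text \<open>Functions that agree on \<open>carrier_vec n\<close> may differ elsewhere;
  \<open>inv_into\<close> selects its values from the carrier, so it does not see the
  difference.\<close>

lemma cond_number_cong:
  assumes "\<And>x. x \<in> carrier_vec n \<Longrightarrow> T x = T' x"
  shows "cond_number n T = cond_number n T'"
proof -
  have "inv_into (carrier_vec n) T = inv_into (carrier_vec n) T'"
    using assms by (auto simp: inv_into_def fun_eq_iff intro!: arg_cong[of _ _ Eps])
  then show ?thesis
    using op_norm_cong[OF assms] by (simp add: cond_number_def)
qed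

lemma finite_image_factor:
  assumes "finite (f ` X)" "\<And>x y. x \<in> X \<Longrightarrow> y \<in> X \<Longrightarrow> f x = f y \<Longrightarrow> g x = g y"
  shows "finite (g ` X)"
proof (rule finite_surj[OF assms(1)])
  show "g ` X \<subseteq> (\<lambda>z. g (SOME x. x \<in> X \<and> f x = z)) ` f ` X"
  proof
    fix w assume "w \<in> g ` X"
    then obtain x where x: "x \<in> X" "w = g x" by auto
    let ?y = "SOME y. y \<in> X \<and> f y = f x"
    have "?y \<in> X \<and> f ?y = f x" by (rule someI[of _ x]) (simp add: x)
    then have "w = g ?y" using assms(2)[of x ?y] x by simp
    then show "w \<in> (\<lambda>z. g (SOME x. x \<in> X \<and> f x = z)) ` f ` X" using x by blast
  qed
qed

text \<open>The norm of the inverse is at least the positive number \<open>M\<close>, so a bound on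
  the condition number bounds \<open>op_norm n T\<close>. The basis of \<open>L1\<close> then goes
  to vectors of \<open>L2\<close> in a fixed ball, which leaves finitely many lists of images, and
  such a list determines \<open>T\<close> on the carrier.\<close>

lemma finite_cond_numbers:
  assumes L: "full_rank_lattice n L1" "full_rank_lattice n L2" and n: "0 < n"
  shows "finite (cond_number n ` {T. linear_map_vec n T \<and> T ` L1 = L2 \<and> cond_number n T \<le> K})"
    (is "finite (_ ` ?X)")
proof -
  obtain bs where bs: "length bs = n" "has_dual bs" "fvec_of ` L1 = int_span bs" "L1 \<subseteq> carrier_vec n"
      "fvecs n = span (set bs)"
    by (rule full_rank_latticeE[OF L(1)])
  obtain cs where cs: "length cs = n" "has_dual cs" "fvec_of ` L2 = int_span cs" "L2 \<subseteq> carrier_vec n"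
      "fvecs n = span (set cs)"
    by (rule full_rank_latticeE[OF L(2)])
  define M where "M = min_ratio n L2 L1"
  have M: "0 < M" unfolding M_def by (rule min_ratio_pos[OF L(2,1) n])
  define R where "R = \<bar>K\<bar> / M * Max (norm ` set bs)"
  define W where "W = {v \<in> int_span cs. norm v \<le> R}"
  have "finite W" unfolding W_def by (rule finite_int_span_ball[OF cs(2)])
  have "map (fvec_map n T) bs \<in> {xs. set xs \<subseteq> W \<and> length xs = n}" if T: "T \<in> ?X" for T
  proof -
    have T': "linear_map_vec n T" "T ` L1 = L2" "cond_number n T \<le> K" using T by auto
    have op: "min_ratio n L1 L2 \<le> op_norm n T" "M \<le> op_norm n (inv_into (carrier_vec n) T)"
      unfolding M_def by (rule cond_number_ge[OF T'(1,2) L n])+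
    have "0 \<le> op_norm n T" using op(1) min_ratio_pos[OF L n] by linarith
    then have "op_norm n T * M \<le> cond_number n T"
      unfolding cond_number_def using op(2) by (rule mult_left_mono[rotated])
    then have "op_norm n T * M \<le> \<bar>K\<bar>" using T'(3) by linarith
    then have le: "op_norm n T \<le> \<bar>K\<bar> / M" using M by (simp add: field_simps)
    have "fvec_map n T b \<in> W" if b: "b \<in> set bs" for b
    proof -
      have "b \<in> fvec_of ` L1" using int_span_base[OF b] bs(3) by simp
      then obtain v where v: "v \<in> L1" "b = fvec_of v" by blast
      then have vc: "v \<in> carrier_vec n" using bs(4) by blast
      have "T v \<in> L2" using v T'(2) by blast
      then have mem: "fvec_of (T v) \<in> int_span cs" using cs(3) by blast
      have "norm (fvec_of (T v)) \<le> op_norm n T * norm b"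
        using eucl_norm_le_op_norm[OF T'(1) vc] v by (simp add: eucl_norm_eq)
      also have "\<dots> \<le> \<bar>K\<bar> / M * Max (norm ` set bs)"
        using le M b \<open>0 \<le> op_norm n T\<close> by (intro mult_mono) auto
      finally show ?thesis using mem v vc by (simp add: W_def R_def)
    qed
    then show ?thesis using bs(1) by auto
  qed
  then have "(\<lambda>T. map (fvec_map n T) bs) ` ?X \<subseteq> {xs. set xs \<subseteq> W \<and> length xs = n}"
    by (rule image_subsetI)
  then have fin: "finite ((\<lambda>T. map (fvec_map n T) bs) ` ?X)"
    by (rule finite_subset) (rule finite_lists_length_eq[OF \<open>finite W\<close>])
  show ?thesis
  proof (rule finite_image_factor[OF fin])
    fix T T' assume T: "T \<in> ?X" "T' \<in> ?X" "map (fvec_map n T) bs = map (fvec_map n T') bs"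
    have lin: "linear_map_vec n T" "linear_map_vec n T'" using T by auto
    show "cond_number n T = cond_number n T'"
    proof (rule cond_number_cong)
      fix x :: "real vec" assume x: "x \<in> carrier_vec n"
      have "fvec_map n T (fvec_of x) = fvec_map n T' (fvec_of x)"
      proof (rule linear_eq_on[OF linear_fvec_map[OF lin(1)] linear_fvec_map[OF lin(2)]])
        show "fvec_of x \<in> span (set bs)" using fvec_of_in_fvecs[OF x] bs(5) by simp
        show "fvec_map n T b = fvec_map n T' b" if "b \<in> set bs" for b
          using T(3) that by simp
      qed
      then have "fvec_of (T x) = fvec_of (T' x)" using x by simp
      then show "T x = T' x"
        using inj_onD[OF inj_on_fvec_of[of n]] linear_map_vecD(1)[OF lin(1) x] linear_map_vecD(1)[OF lin(2) x]
        by blast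
    qed
  qed
qed

section \<open>The upper bound: the map that matches two bases\<close>

definition basis_map :: "nat \<Rightarrow> fvec list \<Rightarrow> fvec list \<Rightarrow> real vec \<Rightarrow> real vec" where
  "basis_map n ds cs v = vec_of n (\<Sum>i<n. inner (fvec_of v) (ds ! i) *\<^sub>R cs ! i)"

lemma linear_basis_map: "linear_map_vec n (basis_map n ds cs)"
proof (rule linear_map_vecI)
  fix x y :: "real vec" and c :: real assume x: "x \<in> carrier_vec n"
  show "basis_map n ds cs (c \<cdot>\<^sub>v x) = c \<cdot>\<^sub>v basis_map n ds cs x"
    by (simp add: basis_map_def fvec_of_smult scaleR_sum_right flip: vec_of_scaleR)
  assume y: "y \<in> carrier_vec n"
  show "basis_map n ds cs (x + y) = basis_map n ds cs x + basis_map n ds cs y"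
    by (simp add: basis_map_def fvec_of_add[OF x y] inner_add_left scaleR_add_left sum.distrib vec_of_add)
qed (simp add: basis_map_def)

lemma fvec_of_basis_map:
  assumes "set cs \<subseteq> fvecs n" "length cs = n"
  shows "fvec_of (basis_map n ds cs v) = (\<Sum>i<n. inner (fvec_of v) (ds ! i) *\<^sub>R cs ! i)"
proof -
  have "(\<Sum>i<n. inner (fvec_of v) (ds ! i) *\<^sub>R cs ! i) \<in> span (set cs)"
    using assms(2) by (intro span_sum span_scale span_base) auto
  then have "(\<Sum>i<n. inner (fvec_of v) (ds ! i) *\<^sub>R cs ! i) \<in> fvecs n"
    using span_subset_fvecs[OF assms(1)] by (rule rev_subsetD)
  then show ?thesis by (simp add: basis_map_def)
qed

lemma basis_map_inverse:
  assumes c: "dual_basis cs ds" "length cs = n" "fvecs n = span (set cs)"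
    and c': "dual_basis cs' ds'" "length cs' = n" "fvecs n = span (set cs')"
    and v: "v \<in> carrier_vec n"
  shows "basis_map n ds' cs (basis_map n ds cs' v) = v"
proof -
  have sub: "set cs \<subseteq> fvecs n" "set cs' \<subseteq> fvecs n"
    using span_superset c(3) c'(3) by auto
  let ?a = "\<lambda>i. inner (fvec_of v) (ds ! i)"
  have coef: "inner (\<Sum>i<n. ?a i *\<^sub>R cs' ! i) (ds' ! j) = ?a j" if "j < n" for j
  proof -
    have "inner (\<Sum>i<n. ?a i *\<^sub>R cs' ! i) (ds' ! j) = (\<Sum>i<n. if i = j then ?a j else 0)"
      unfolding inner_sum_left using that dual_basisD[OF c'(1)] c'(2) by (intro sum.cong) auto
    then show ?thesis using that by simp
  qed
  have "fvec_of (basis_map n ds' cs (basis_map n ds cs' v)) = (\<Sum>i<n. ?a i *\<^sub>R cs ! i)"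
    unfolding fvec_of_basis_map[OF sub(1) c(2)] fvec_of_basis_map[OF sub(2) c'(2)]
    by (intro sum.cong) (simp_all add: coef)
  also have "\<dots> = fvec_of v"
    using span_eq_sum_dual[OF c(1), of "fvec_of v"] fvec_of_in_fvecs[OF v] c(2,3) by simp
  finally have "vec_of n (fvec_of (basis_map n ds' cs (basis_map n ds cs' v))) = vec_of n (fvec_of v)"
    by simp
  then show ?thesis
    using v linear_map_vecD(1)[OF linear_basis_map v, of ds cs']
      linear_map_vecD(1)[OF linear_basis_map] by simp
qed

lemma basis_map_lattice_subset:
  assumes c: "dual_basis cs ds" "length cs = n" "int_span cs = fvec_of ` L"
    and c': "length cs' = n" "int_span cs' = fvec_of ` L'" "set cs' \<subseteq> fvecs n"
    and L': "L' \<subseteq> carrier_vec n" and v: "v \<in> L"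
  shows "basis_map n ds cs' v \<in> L'"
proof -
  have mem: "fvec_of v \<in> int_span cs" using v c(3) by blast
  then have "\<forall>i<n. \<exists>k::int. inner (fvec_of v) (ds ! i) = of_int k"
    using inner_int_span_dual_Ints[OF c(1) mem] c(2) by (auto elim!: Ints_cases)
  then obtain z :: "nat \<Rightarrow> int" where z: "\<And>i. i < n \<Longrightarrow> inner (fvec_of v) (ds ! i) = of_int (z i)"
    by metis
  have "fvec_of (basis_map n ds cs' v) = (\<Sum>i<n. of_int (z i) *\<^sub>R cs' ! i)"
    unfolding fvec_of_basis_map[OF c'(3,1)] by (intro sum.cong) (simp_all add: z)
  also have "\<dots> \<in> int_span cs'"
    unfolding int_span_conv_sum c'(1) by (rule rangeI)
  finally obtain w where w: "w \<in> L'" "fvec_of (basis_map n ds cs' v) = fvec_of w"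
    unfolding c'(2) by blast
  have "basis_map n ds cs' v \<in> carrier_vec n" by (simp add: basis_map_def)
  then have "basis_map n ds cs' v = w"
    using inj_onD[OF inj_on_fvec_of[of n] w(2)] w(1) L' by blast
  then show ?thesis using w(1) by simp
qed

text \<open>Each of the \<open>n\<close> rank-one terms has norm at most
  \<open>norm (ds ! i) * norm (cs ! i)\<close>; the two factors \<open>K\<close> multiply and the
  minima combine to one of the ratios in \<open>min_ratio\<close>.\<close>

lemma op_norm_basis_map_le:
  assumes L: "full_rank_lattice n L1" "full_rank_lattice n L2" and n: "0 < n" and K: "0 < K"
    and c: "\<And>i. i < n \<Longrightarrow> norm (ds ! i) \<le> K / succ_min n (Suc i) L1"
    and c': "\<And>i. i < n \<Longrightarrow> norm (cs ! i) \<le> K * succ_min n (Suc i) L2" "set cs \<subseteq> fvecs n" "length cs = n"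
  shows "op_norm n (basis_map n ds cs) \<le> real n * K\<^sup>2 * min_ratio n L1 L2"
proof (rule op_norm_le[OF n])
  fix v :: "real vec"
  let ?M = "min_ratio n L1 L2"
  have "eucl_norm (basis_map n ds cs v) \<le> (\<Sum>i<n. norm (inner (fvec_of v) (ds ! i) *\<^sub>R cs ! i))"
    unfolding eucl_norm_eq fvec_of_basis_map[OF c'(2,3)] by (rule norm_sum)
  also have "\<dots> \<le> (\<Sum>i<n. norm (fvec_of v) * (K\<^sup>2 * ?M))"
  proof (rule sum_mono)
    fix i assume "i \<in> {..<n}"
    then have i: "i < n" by simp
    have l: "0 < succ_min n (Suc i) L1" "0 < succ_min n (Suc i) L2"
      using succ_min_works(1)[OF L(1), of "Suc i"] succ_min_works(1)[OF L(2), of "Suc i"] i by auto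
    have "norm (ds ! i) * norm (cs ! i) \<le> (K / succ_min n (Suc i) L1) * (K * succ_min n (Suc i) L2)"
      using c[OF i] c'(1)[OF i] l K by (intro mult_mono) auto
    also have "\<dots> = K\<^sup>2 * (succ_min n (Suc i) L2 / succ_min n (Suc i) L1)"
      by (simp add: power2_eq_square)
    also have "\<dots> \<le> K\<^sup>2 * ?M"
      using min_ratio_ge[of "Suc i" n L2 L1] i by (intro mult_left_mono) auto
    finally have prod: "norm (ds ! i) * norm (cs ! i) \<le> K\<^sup>2 * ?M" .
    have "norm (inner (fvec_of v) (ds ! i) *\<^sub>R cs ! i) \<le> (norm (fvec_of v) * norm (ds ! i)) * norm (cs ! i)"
      using mult_right_mono[OF Cauchy_Schwarz_ineq2[of "fvec_of v" "ds ! i"] norm_ge_zero[of "cs ! i"]] by simp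
    also have "\<dots> \<le> norm (fvec_of v) * (K\<^sup>2 * ?M)"
      using mult_left_mono[OF prod norm_ge_zero[of "fvec_of v"]] by (simp add: mult.assoc)
    finally show "norm (inner (fvec_of v) (ds ! i) *\<^sub>R cs ! i) \<le> norm (fvec_of v) * (K\<^sup>2 * ?M)" .
  qed
  finally show "eucl_norm (basis_map n ds cs v) \<le> real n * K\<^sup>2 * ?M * eucl_norm v"
    by (simp add: eucl_norm_eq mult_ac)
qed

lemma ex_lattice_map_cond_number_le:
  assumes L: "full_rank_lattice n L1" "full_rank_lattice n L2" and n: "2 \<le> n"
  defines "K \<equiv> exp (26 * (ln n)\<^sup>2)"
  shows "\<exists>T. linear_map_vec n T \<and> T ` L1 = L2 \<and>
    cond_number n T \<le> (real n * K\<^sup>2)\<^sup>2 * (min_ratio n L1 L2 * min_ratio n L2 L1)"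
proof -
  have n0: "0 < n" and K: "0 < K" using n by (auto simp: K_def)
  note car = full_rank_lattice_carrier[OF L(1)] full_rank_lattice_carrier[OF L(2)]
  obtain cs ds where c: "length cs = n" "dual_basis cs ds" "int_span cs = fvec_of ` L1" "fvecs n = span (set cs)"
      "\<forall>i<n. norm (cs ! i) \<le> K * succ_min n (Suc i) L1 \<and> norm (ds ! i) \<le> K / succ_min n (Suc i) L1"
    using ex_well_conditioned_basis[OF L(1) n] unfolding K_def by blast
  obtain cs' ds' where c': "length cs' = n" "dual_basis cs' ds'" "int_span cs' = fvec_of ` L2" "fvecs n = span (set cs')"
      "\<forall>i<n. norm (cs' ! i) \<le> K * succ_min n (Suc i) L2 \<and> norm (ds' ! i) \<le> K / succ_min n (Suc i) L2"
    using ex_well_conditioned_basis[OF L(2) n] unfolding K_def by blast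
  have sub: "set cs \<subseteq> fvecs n" "set cs' \<subseteq> fvecs n"
    using span_superset c(4) c'(4) by auto
  define T where "T = basis_map n ds cs'"
  \<comment> \<open>The inverse has the same form with the two bases exchanged, so one norm estimate
    serves both factors of the condition number.\<close>
  define G where "G = basis_map n ds' cs"
  have lin: "linear_map_vec n T" "linear_map_vec n G" by (simp_all add: T_def G_def linear_basis_map)
  have GT: "G (T v) = v" if "v \<in> carrier_vec n" for v
    unfolding T_def G_def by (rule basis_map_inverse[OF c(2,1,4) c'(2,1,4) that])
  have TG: "T (G v) = v" if "v \<in> carrier_vec n" for v
    unfolding T_def G_def by (rule basis_map_inverse[OF c'(2,1,4) c(2,1,4) that])
  have TL: "T v \<in> L2" if "v \<in> L1" for v
    unfolding T_def by (rule basis_map_lattice_subset[OF c(2,1,3) c'(1,3) sub(2) car(2) that])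
  have GL: "G v \<in> L1" if "v \<in> L2" for v
    unfolding G_def by (rule basis_map_lattice_subset[OF c'(2,1,3) c(1,3) sub(1) car(1) that])
  have im: "T ` L1 = L2"
  proof (intro equalityI subsetI)
    fix w assume w: "w \<in> L2"
    then have "T (G w) = w" using TG car(2) by blast
    then show "w \<in> T ` L1" using GL[OF w] by (metis imageI)
  qed (use TL in blast)
  have inv: "inv_into (carrier_vec n) T w = G w" if w: "w \<in> carrier_vec n" for w
  proof -
    have "inj_on T (carrier_vec n)" by (rule inj_on_inverseI[of _ G]) (rule GT)
    then have "inv_into (carrier_vec n) T (T (G w)) = G w"
      using linear_map_vecD(1)[OF lin(2) w] by (rule inv_into_f_f)
    then show ?thesis using TG[OF w] by simp
  qed
  have 1: "op_norm n T \<le> real n * K\<^sup>2 * min_ratio n L1 L2"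
    unfolding T_def using c(5) c'(5) by (intro op_norm_basis_map_le[OF L n0 K _ _ sub(2) c'(1)]) auto
  have "op_norm n G \<le> real n * K\<^sup>2 * min_ratio n L2 L1"
    unfolding G_def using c(5) c'(5) by (intro op_norm_basis_map_le[OF L(2,1) n0 K _ _ sub(1) c(1)]) auto
  then have 2: "op_norm n (inv_into (carrier_vec n) T) \<le> real n * K\<^sup>2 * min_ratio n L2 L1"
    using op_norm_cong[OF inv] by simp
  have pos: "0 \<le> op_norm n (inv_into (carrier_vec n) T)" "0 \<le> min_ratio n L1 L2"
    using cond_number_ge(2)[OF lin(1) im L n0] min_ratio_pos[OF L n0] min_ratio_pos[OF L(2,1) n0] by linarith+
  have "cond_number n T \<le> (real n * K\<^sup>2 * min_ratio n L1 L2) * (real n * K\<^sup>2 * min_ratio n L2 L1)"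
    unfolding cond_number_def using 1 2 pos by (intro mult_mono) auto
  then have "cond_number n T \<le> (real n * K\<^sup>2)\<^sup>2 * (min_ratio n L1 L2 * min_ratio n L2 L1)"
    by (simp add: power2_eq_square mult_ac)
  with lin(1) im show ?thesis by blast
qed

text \<open>Below \<open>k0\<close> there are finitely many candidates, so their minimum is least
  among all.\<close>

lemma Least_finite_below:
  fixes P :: "real \<Rightarrow> bool"
  assumes "P k0" "finite {k. P k \<and> k \<le> k0}"
  shows "P (Least P)" "Least P \<le> k0"
proof -
  let ?m = "Min {k. P k \<and> k \<le> k0}"
  have m: "?m \<in> {k. P k \<and> k \<le> k0}" using assms by (intro Min_in) auto
  have "Least P = ?m"
  proof (rule Least_equality)
    show "P ?m" using m by blast
    fix y assume "P y"
    then show "?m \<le> y" using m assms(2) by (cases "y \<le> k0") (auto intro: Min_le)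
  qed
  with m show "P (Least P)" "Least P \<le> k0" by auto
qed

text \<open>With \<open>x = ln n\<close> the left side is \<open>exp (2 x + 104 x^2)\<close>, where
  104 is four times 26. Since \<open>x \<ge> 1/2\<close>, the linear term is at most
  \<open>4 x^2\<close>, which gives 108.\<close>

lemma distortion_constant_le:
  assumes "2 \<le> n"
  shows "(real n * (exp (26 * (ln n)\<^sup>2))\<^sup>2)\<^sup>2 \<le> real n powr (108 * ln n)"
proof -
  let ?x = "ln (real n)"
  have "1 / 2 \<le> ln (2::real)"
    using ln_le_minus_one[of "1 / 2 :: real"] by (simp add: ln_div)
  moreover have "ln 2 \<le> ?x" using assms by simp
  ultimately have "1 / 2 * ?x \<le> ?x * ?x" by (intro mult_right_mono) auto
  then have x: "?x \<le> 2 * ?x\<^sup>2" by (simp add: power2_eq_square)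
  have "real n = exp ?x" using assms by simp
  then have "(real n * (exp (26 * ?x\<^sup>2))\<^sup>2)\<^sup>2 = (exp ?x * (exp (26 * ?x\<^sup>2))\<^sup>2)\<^sup>2" by simp
  also have "\<dots> = exp (2 * ?x + 104 * ?x\<^sup>2)"
    by (simp add: power2_eq_square flip: exp_add)
  also have "\<dots> \<le> exp (108 * ?x\<^sup>2)" using x by simp
  also have "\<dots> = real n powr (108 * ?x)"
    using assms by (simp add: powr_def power2_eq_square)
  finally show ?thesis .
qed

theorem theorem1p1:
  shows "\<exists>C::real. C > 0 \<and>
    (\<forall>n::nat. \<forall>L1 L2 :: real vec set.
      n \<ge> 2 \<longrightarrow> full_rank_lattice n L1 \<longrightarrow> full_rank_lattice n L2 \<longrightarrow>
        min_ratio n L1 L2 * min_ratio n L2 L1 \<le> lattice_distortion n L1 L2 \<and>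
        lattice_distortion n L1 L2
          \<le> real n powr (C * ln (real n)) * (min_ratio n L1 L2 * min_ratio n L2 L1))"
proof (rule exI[of _ 108], intro conjI allI impI)
  fix n :: nat and L1 L2 :: "real vec set"
  assume n: "2 \<le> n" and L: "full_rank_lattice n L1" "full_rank_lattice n L2"
  let ?MM = "min_ratio n L1 L2 * min_ratio n L2 L1"
  let ?P = "\<lambda>k. \<exists>T. linear_map_vec n T \<and> T ` L1 = L2 \<and> k = cond_number n T"
  have n0: "0 < n" using n by simp
  have MM: "0 \<le> min_ratio n L1 L2" "0 \<le> min_ratio n L2 L1"
    using min_ratio_pos[OF L n0] min_ratio_pos[OF L(2,1) n0] by linarith+
  obtain T where T: "linear_map_vec n T" "T ` L1 = L2"
      "cond_number n T \<le> (real n * (exp (26 * (ln n)\<^sup>2))\<^sup>2)\<^sup>2 * ?MM"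
    using ex_lattice_map_cond_number_le[OF L n] by blast
  have "{k. ?P k \<and> k \<le> cond_number n T}
      = cond_number n ` {S. linear_map_vec n S \<and> S ` L1 = L2 \<and> cond_number n S \<le> cond_number n T}"
    by blast
  then have fin: "finite {k. ?P k \<and> k \<le> cond_number n T}"
    using finite_cond_numbers[OF L n0] by simp
  have PT: "?P (cond_number n T)" using T by blast
  \<comment> \<open>The distortion is the condition number of an actual map, to which the lower
    bound applies, and it is at most that of the map \<open>T\<close> built from the two
    bases.\<close>
  note least = Least_finite_below[of ?P, OF PT fin, folded lattice_distortion_def]
  show "?MM \<le> lattice_distortion n L1 L2"
  proof -
    obtain S where S: "linear_map_vec n S" "S ` L1 = L2" "lattice_distortion n L1 L2 = cond_number n S"
      using least(1) by blast
    show ?thesis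
      unfolding S(3) cond_number_def using cond_number_ge[OF S(1,2) L n0] MM
      by (intro mult_mono) linarith+
  qed
  have "lattice_distortion n L1 L2 \<le> (real n * (exp (26 * (ln n)\<^sup>2))\<^sup>2)\<^sup>2 * ?MM"
    using least(2) T(3) by linarith
  also have "\<dots> \<le> real n powr (108 * ln n) * ?MM"
    using distortion_constant_le[OF n] MM by (intro mult_right_mono) auto
  finally show "lattice_distortion n L1 L2 \<le> real n powr (108 * ln (real n)) * ?MM" .
qed simp

end
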